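(* Let $\pi_{\rm joint}(\mathrm{d}\mathbf{x},\mathrm{d}\mathbf{y})=\pi_{\rm cond}(\mathrm{d}\mathbf{x}\mid\mathbf{y})\,\pi_{\rm marg}(\mathrm{d}\mathbf{y})$ be a probability distribution on $\mathbb{R}^{n_x}\times\mathbb{R}^{n_y}$ that is absolutely continuous with respect to Lebesgue measure. Let $k_{\tt M}$ and $k_{\tt B}$ be the MarCo and OneBlockMH transition kernels built from the same marginal proposal distribution $q_{\rm marg}$. Then $$\operatorname{Gap}_R(k_{\tt M})\ge\operatorname{Gap}_R(k_{\tt B})\qquad\text{and}\qquad\operatorname{var}(f,k_{\tt M})\le\operatorname{var}(f,k_{\tt B})$$ for any $\pi_{\rm joint}$-square-integrable function $f$.
   Context: The same symbol is used for a distribution and its density. $\pi_{\rm marg}(\mathbf{y})=\int\pi_{\rm joint}(\mathbf{x},\mathbf{y})\,\mathrm{d}\mathbf{x}$ and $\pi_{\rm cond}(\cdot\mid\mathbf{y})$ is the conditional distribution of $\mathbf{x}$ given $\mathbf{y}$, with a density on $\mathbb{R}^{n_x}$. $q_{\rm marg}(\hat{\mathbf{y}}\mid\mathbf{y})$ is a proposal density on $\mathbb{R}^{n_y}$, and $$\alpha_{\rm marg}(\mathbf{y},\hat{\mathbf{y}})=\min\Big\{1,\frac{\pi_{\rm marg}(\hat{\mathbf{y}})\,q_{\rm marg}(\mathbf{y}\mid\hat{\mathbf{y}})}{\pi_{\rm marg}(\mathbf{y})\,q_{\rm marg}(\hat{\mathbf{y}}\mid\mathbf{y})}\Big\},\qquad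 r_{\rm marg}(\mathbf{y})=1-\int_{\mathbb{R}^{n_y}}q_{\rm marg}(\tilde{\mathbf{y}}\mid\mathbf{y})\,\alpha_{\rm marg}(\mathbf{y},\tilde{\mathbf{y}})\,\mathrm{d}\tilde{\mathbf{y}}$$ (with the usual convention $\alpha_{\rm marg}=1$ when the denominator vanishes). MarCo kernel: $$k_{\tt M}((\mathbf{x},\mathbf{y}),(\mathrm{d}\hat{\mathbf{x}},\mathrm{d}\hat{\mathbf{y}}))=\pi_{\rm cond}(\mathrm{d}\hat{\mathbf{x}}\mid\hat{\mathbf{y}})\big[q_{\rm marg}(\hat{\mathbf{y}}\mid\mathbf{y})\,\alpha_{\rm marg}(\mathbf{y},\hat{\mathbf{y}})\,\mathrm{d}\hat{\mathbf{y}}+r_{\rm marg}(\mathbf{y})\,\delta_{\mathbf{y}}(\mathrm{d}\hat{\mathbf{y}})\big].$$ OneBlockMH kernel: $$k_{\tt B}((\mathbf{x},\mathbf{y}),(\mathrm{d}\hat{\mathbf{x}},\mathrm{d}\hat{\mathbf{y}}))=\pi_{\rm cond}(\mathrm{d}\hat{\mathbf{x}}\mid\hat{\mathbf{y}})\,q_{\rm marg}(\hat{\mathbf{y}}\mid\mathbf{y})\,\alpha_{\rm marg}(\mathbf{y},\hat{\mathbf{y}})\,\mathrm{d}\hat{\mathbf{y}}+r_{\rm marg}(\mathbf{y})\,\delta_{(\mathbf{x},\mathbf{y})}(\mathrm{d}\hat{\mathbf{x}},\mathrm{d}\hat{\mathbf{y}}).$$ Both kernels are $\pi_{\rm joint}$-reversible.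 For a $\pi$-reversible kernel $k$, regarded as a self-adjoint operator on $L^2(\pi)$, let $\mathcal{S}_0(k)$ be its spectrum restricted to the subspace of mean-zero functions. The right spectral gap is $\operatorname{Gap}_R(k)=1-\sup\{\lambda:\lambda\in\mathcal{S}_0(k)\}$. The asymptotic variance of $f\in L^2(\pi)$ is $\operatorname{var}(f,k)=\lim_{T\to\infty}T\cdot\operatorname{var}\big(\frac1T\sum_{t=1}^Tf(\mathbf{Z}^t)\big)\in[0,\infty]$, where $(\mathbf{Z}^t)_{t\ge0}$ is the Markov chain with kernel $k$ started in stationarity, $\mathbf{Z}^0\sim\pi$. *)

theory Defs
  imports "HOL-Probability.Probability"
begin

section \<open>Square-integrable functions, spectral gap\<close>

text \<open>
  Elements of \<open>L\<^sup>2(\<pi>)\<close> are represented by measurable functions; identification up to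
  \<open>\<pi>\<close>-null sets is made explicit (\<open>AE\<close>) where it matters.
\<close>

definition square_integrable :: "'z measure \<Rightarrow> ('z \<Rightarrow> real) set" where
  "square_integrable \<pi> = {f \<in> borel_measurable \<pi>. integrable \<pi> (\<lambda>z. (f z)\<^sup>2)}"

definition mean_zero :: "'z measure \<Rightarrow> ('z \<Rightarrow> real) set" where
  "mean_zero \<pi> = {f \<in> square_integrable \<pi>. (\<integral>z. f z \<partial>\<pi>) = 0}"

definition L2_norm :: "'z measure \<Rightarrow> ('z \<Rightarrow> real) \<Rightarrow> real" where
  "L2_norm \<pi> f = sqrt (\<integral>z. (f z)\<^sup>2 \<partial>\<pi>)"

definition kernel_op :: "('z \<Rightarrow> 'z measure) \<Rightarrow> ('z \<Rightarrow> real) \<Rightarrow> 'z \<Rightarrow> real" where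
  "kernel_op k f z = (\<integral>w. f w \<partial>(k z))"

text \<open>
  \<open>s\<close> is a regular value if \<open>s I - k\<close>, as an operator on the mean-zero subspace of
  \<open>L\<^sup>2(\<pi>)\<close>, is onto, one-to-one and has a bounded inverse.  Since the operator is self-adjoint
  for reversible \<open>k\<close>, its spectrum is real, so real functions and real \<open>s\<close> suffice.
\<close>

definition regular_value0 :: "'z measure \<Rightarrow> ('z \<Rightarrow> 'z measure) \<Rightarrow> real \<Rightarrow> bool" where
  "regular_value0 \<pi> k s \<longleftrightarrow>
     (\<forall>g \<in> mean_zero \<pi>. \<exists>h \<in> mean_zero \<pi>. AE z in \<pi>. s * h z - kernel_op k h z = g z) \<and>
     (\<forall>h \<in> mean_zero \<pi>. (AE z in \<pi>. s * h z - kernel_op k h z = 0) \<longrightarrow> (AE z in \<pi>. h z = 0)) \<and>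
     (\<exists>C. \<forall>h \<in> mean_zero \<pi>. L2_norm \<pi> h \<le> C * L2_norm \<pi> (\<lambda>z. s * h z - kernel_op k h z))"

definition spectrum0 :: "'z measure \<Rightarrow> ('z \<Rightarrow> 'z measure) \<Rightarrow> real set" where
  "spectrum0 \<pi> k = {s. \<not> regular_value0 \<pi> k s}"

definition right_gap :: "'z measure \<Rightarrow> ('z \<Rightarrow> 'z measure) \<Rightarrow> real" where
  "right_gap \<pi> k = 1 - Sup (spectrum0 \<pi> k)"


section \<open>Stationary Markov chains, asymptotic variance\<close>

text \<open>
  The law on path space of the chain with initial distribution \<open>\<pi>\<close> and transition kernel \<open>k\<close>,
  given by the Ionescu-Tulcea theorem; the state \<open>Z\<^sup>t\<close> is the coordinate \<open>\<lambda>\<omega>. \<omega> t\<close>.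
\<close>

definition chain_step ::
    "'z measure \<Rightarrow> ('z \<Rightarrow> 'z measure) \<Rightarrow> nat \<Rightarrow> (nat \<Rightarrow> 'z) \<Rightarrow> 'z measure" where
  "chain_step \<pi> k t \<omega> = (case t of 0 \<Rightarrow> \<pi> | Suc s \<Rightarrow> k (\<omega> s))"

definition chain_law :: "'z measure \<Rightarrow> ('z \<Rightarrow> 'z measure) \<Rightarrow> (nat \<Rightarrow> 'z) measure" where
  "chain_law \<pi> k =
     projective_family.lim UNIV (Ionescu_Tulcea.CI (chain_step \<pi> k) (\<lambda>_. \<pi>)) (\<lambda>_. \<pi>)"

definition variance_of :: "'p measure \<Rightarrow> ('p \<Rightarrow> real) \<Rightarrow> real" where
  "variance_of P X = (\<integral>\<omega>. (X \<omega> - (\<integral>\<omega>'. X \<omega>' \<partial>P))\<^sup>2 \<partial>P)"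

definition asymp_var :: "'z measure \<Rightarrow> ('z \<Rightarrow> 'z measure) \<Rightarrow> ('z \<Rightarrow> real) \<Rightarrow> ereal" where
  "asymp_var \<pi> k f =
     lim (\<lambda>T. ereal (real T *
       variance_of (chain_law \<pi> k) (\<lambda>\<omega>. (1 / real T) * (\<Sum>t = 1..T. f (\<omega> t)))))"


section \<open>The MarCo and OneBlockMH kernels\<close>

text \<open>\<open>g y\<close> is a probability density for every \<open>y\<close>: the argument order is \<open>g y x = g(x | y)\<close>.\<close>

definition conditional_density ::
    "('b::euclidean_space \<Rightarrow> 'a::euclidean_space \<Rightarrow> real) \<Rightarrow> bool" where
  "conditional_density g \<longleftrightarrow>
     (\<lambda>(y, x). g y x) \<in> borel_measurable borel \<and>
     (\<forall>y x. 0 \<le> g y x) \<and>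
     (\<forall>y. (\<integral>\<^sup>+x. ennreal (g y x) \<partial>lborel) = 1)"

definition cond_dist ::
    "('b::euclidean_space \<Rightarrow> 'a::euclidean_space \<Rightarrow> real) \<Rightarrow> 'b \<Rightarrow> 'a measure" where
  "cond_dist g y = density lborel (\<lambda>x. ennreal (g y x))"

definition accept_marg :: "('b \<Rightarrow> real) \<Rightarrow> ('b \<Rightarrow> 'b \<Rightarrow> real) \<Rightarrow> 'b \<Rightarrow> 'b \<Rightarrow> real" where
  "accept_marg p q y y' =
     (if p y * q y y' = 0 then 1 else min 1 ((p y' * q y' y) / (p y * q y y')))"

definition reject_marg ::
    "('b::euclidean_space \<Rightarrow> real) \<Rightarrow> ('b \<Rightarrow> 'b \<Rightarrow> real) \<Rightarrow> 'b \<Rightarrow> real" where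
  "reject_marg p q y = 1 - (\<integral>y'. q y y' * accept_marg p q y y' \<partial>lborel)"

text \<open>
  \<open>c\<close> is the density of the conditional distribution of \<open>x\<close> given \<open>y\<close>, \<open>p\<close> the marginal density of
  \<open>y\<close>, \<open>q\<close> the marginal proposal density.  The kernels are given by their values on Borel sets \<open>A\<close>,
  where \<open>emeasure (cond_dist c y') {x'. (x', y') \<in> A}\<close> is the conditional probability of
  \<open>(x', y') \<in> A\<close> given \<open>y'\<close>.
\<close>

definition marco_kernel ::
    "('b::euclidean_space \<Rightarrow> 'a::euclidean_space \<Rightarrow> real) \<Rightarrow> ('b \<Rightarrow> real) \<Rightarrow> ('b \<Rightarrow> 'b \<Rightarrow> real) \<Rightarrow>
     'a \<times> 'b \<Rightarrow> ('a \<times> 'b) measure" where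
  "marco_kernel c p q = (\<lambda>(x, y). measure_of UNIV (sets borel) (\<lambda>A.
     (\<integral>\<^sup>+y'. emeasure (cond_dist c y') {x'. (x', y') \<in> A} *
            ennreal (q y y' * accept_marg p q y y') \<partial>lborel)
     + ennreal (reject_marg p q y) * emeasure (cond_dist c y) {x'. (x', y) \<in> A}))"

definition oneblock_kernel ::
    "('b::euclidean_space \<Rightarrow> 'a::euclidean_space \<Rightarrow> real) \<Rightarrow> ('b \<Rightarrow> real) \<Rightarrow> ('b \<Rightarrow> 'b \<Rightarrow> real) \<Rightarrow>
     'a \<times> 'b \<Rightarrow> ('a \<times> 'b) measure" where
  "oneblock_kernel c p q = (\<lambda>(x, y). measure_of UNIV (sets borel) (\<lambda>A.
     (\<integral>\<^sup>+y'. emeasure (cond_dist c y') {x'. (x', y') \<in> A} *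
            ennreal (q y y' * accept_marg p q y y') \<partial>lborel)
     + ennreal (reject_marg p q y) * indicator A (x, y)))"

end

theory Submission
  imports Defs
begin

text \<open>
  Let \<open>E\<close> be the kernel that redraws \<open>x\<close> from its conditional distribution given \<open>y\<close>; on functions
  it is the conditional expectation given \<open>y\<close>, an orthogonal projection of \<open>L\<^sup>2(\<pi>)\<close>.  Let \<open>r(y)\<close> be
  the probability that the marginal chain rejects.  A function \<open>f\<close> is mapped by OneBlockMH to
  \<open>B f = A f + r f\<close> and by MarCo to \<open>M f = A f + r E f\<close>, where \<open>A f\<close>, the contribution of the accepted
  moves, is a function of \<open>y\<close> alone and depends on \<open>f\<close> only through \<open>E f\<close>.  Consequently
  \<open>M = B E = E B\<close> and \<open>B = M + r (1 - E)\<close>: both operators respect the orthogonal decomposition of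
  \<open>L\<^sup>2(\<pi>)\<close> into the range of \<open>E\<close>, where they agree, and the kernel of \<open>E\<close>, where \<open>M\<close> vanishes and \<open>B\<close>
  multiplies by \<open>r\<close>.  The locale \<open>refreshment\<close> records this situation, and the two inequalities
  are proved there.

  For \<open>k \<ge> 1\<close> the decomposition gives
  \<open>B\<^sup>k f = M\<^sup>k f + r\<^sup>k (f - E f)\<close>, so the lag-\<open>k\<close> autocovariances differ by
  \<open>\<integral> r\<^sup>k (f - E f)\<^sup>2 d\<pi> \<ge> 0\<close>; at lag zero they agree.  The variance of a time average over \<open>T\<close>
  steps is a combination of autocovariances with nonnegative coefficients, and the
  inequality holds for each \<open>T\<close> before any limit is taken (\<open>autocov_le\<close>).  It passes to the limit once both
  limits are known to exist in \<open>[0, \<infinity>]\<close>.  This is a general fact about reversible kernels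
  (\<open>scaled_variance_tendsto_asymp_var\<close>), obtained here without the spectral theorem: by self-adjointness the
  even autocovariances \<open>\<gamma>\<^sub>2\<^sub>m = \<parallel>K\<^sup>m g\<parallel>\<^sup>2\<close> are nonnegative and nonincreasing, and
  \<open>\<gamma>\<^sub>2\<^sub>m + \<gamma>\<^sub>2\<^sub>m\<^sub>+\<^sub>1 = \<langle>K\<^sup>m g, (1 + K) K\<^sup>m g\<rangle> \<ge> 0\<close>, which is enough for the Cesaro means of the
  partial sums to converge.

  For the spectral gap, a nonzero regular value of \<open>B\<close> is regular for \<open>M\<close>: on the range of \<open>E\<close> one inverts as for
  \<open>B\<close>, on the kernel of \<open>E\<close> one divides by \<open>s\<close> (\<open>regular_value0_transfer\<close>).  The value \<open>0\<close>, which
  does belong to the spectrum of \<open>M\<close>, is dominated by a nonnegative point of the spectrum of \<open>B\<close>, namely the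
  essential supremum of \<open>r\<close> (\<open>spectrum0_nonneg_point\<close>).  The suprema can then be compared because the spectrum
  of \<open>B\<close> is bounded above (\<open>bdd_above_spectrum0\<close>).  Both statements about particular points rest on a function that is
  nonzero almost everywhere and has conditional mean zero; it exists because the
  conditional distributions have densities, hence are not point masses.
\<close>

section \<open>Integrals against a composed kernel\<close>

lemma integrable_imp_nn_finite:
  fixes f :: "'a \<Rightarrow> real"
  assumes "integrable M f"
  shows "(\<integral>\<^sup>+x. ennreal (f x) \<partial>M) < \<infinity>"
  using assms by (metis real_integrable_def infinity_ennreal_def less_top)

text \<open>
  The integral against a composed measure, for integrable functions that need not be bounded.  Under almost every
  transition measure both the positive and the negative part have finite integral, so the signed identity is the
  difference of the two nonnegative ones.
\<close>

lemma
  fixes f :: "'b \<Rightarrow> real"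
  assumes N[measurable]: "N \<in> M \<rightarrow>\<^sub>M subprob_algebra B"
    and ne: "space M \<noteq> {}"
    and f: "integrable (M \<bind> N) f"
  shows AE_integrable_bind: "AE x in M. integrable (N x) f"
    and integrable_integral_bind: "integrable M (\<lambda>x. \<integral>y. f y \<partial>N x)"
    and integral_bind_integrable: "(\<integral>y. f y \<partial>(M \<bind> N)) = (\<integral>x. (\<integral>y. f y \<partial>N x) \<partial>M)"
proof -
  have sets_bind_N: "sets (M \<bind> N) = sets B"
    by (rule sets_bind[OF sets_kernel[OF N] ne])
  have fm[measurable]: "f \<in> borel_measurable B"
    using borel_measurable_integrable[OF f] by (simp add: measurable_cong_sets[OF sets_bind_N refl])
  let ?p = "\<lambda>x. \<integral>\<^sup>+y. ennreal (f y) \<partial>N x" and ?m = "\<lambda>x. \<integral>\<^sup>+y. ennreal (- f y) \<partial>N x"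
  have pmeas[measurable]: "?p \<in> borel_measurable M" and mmeas[measurable]: "?m \<in> borel_measurable M"
    by measurable
  have p: "(\<integral>\<^sup>+y. ennreal (f y) \<partial>(M \<bind> N)) = (\<integral>\<^sup>+x. ?p x \<partial>M)"
    by (rule nn_integral_bind[where B=B]) measurable
  have m: "(\<integral>\<^sup>+y. ennreal (- f y) \<partial>(M \<bind> N)) = (\<integral>\<^sup>+x. ?m x \<partial>M)"
    by (rule nn_integral_bind[where B=B]) measurable
  have pfin: "(\<integral>\<^sup>+x. ?p x \<partial>M) < \<infinity>"
    using integrable_imp_nn_finite[OF f] p by simp
  have mfin: "(\<integral>\<^sup>+x. ?m x \<partial>M) < \<infinity>"
    using integrable_imp_nn_finite[of "M \<bind> N" "\<lambda>y. - f y"] f m by simp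
  have AEp: "AE x in M. ?p x \<noteq> \<infinity>"
    using pfin by (intro nn_integral_PInf_AE) (auto simp: less_top)
  have AEm: "AE x in M. ?m x \<noteq> \<infinity>"
    using mfin by (intro nn_integral_PInf_AE) (auto simp: less_top)
  have fN: "f \<in> borel_measurable (N x)" if "x \<in> space M" for x
    using fm by (simp add: measurable_cong_sets[OF sets_kernel[OF N that] refl])
  show *: "AE x in M. integrable (N x) f"
    using AEp AEm AE_space by eventually_elim (auto simp: real_integrable_def fN)
  have eqp: "AE x in M. ennreal (enn2real (?p x)) = ?p x"
    using AEp by eventually_elim (simp add: less_top)
  have eqm: "AE x in M. ennreal (enn2real (?m x)) = ?m x"
    using AEm by eventually_elim (simp add: less_top)
  have ip: "integrable M (\<lambda>x. enn2real (?p x))"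
    using pfin nn_integral_cong_AE[OF eqp] by (intro integrableI_nonneg) auto
  have im: "integrable M (\<lambda>x. enn2real (?m x))"
    using mfin nn_integral_cong_AE[OF eqm] by (intro integrableI_nonneg) auto
  have split: "AE x in M. (\<integral>y. f y \<partial>N x) = enn2real (?p x) - enn2real (?m x)"
    using * by eventually_elim (rule real_lebesgue_integral_def)
  have meas: "(\<lambda>x. \<integral>y. f y \<partial>N x) \<in> borel_measurable M"
    by measurable
  have "integrable M (\<lambda>x. enn2real (?p x) - enn2real (?m x))"
    using ip im by simp
  then show "integrable M (\<lambda>x. \<integral>y. f y \<partial>N x)"
    using split by (subst integrable_cong_AE) (use meas in \<open>auto\<close>)
  have "(\<integral>x. (\<integral>y. f y \<partial>N x) \<partial>M) = (\<integral>x. enn2real (?p x) - enn2real (?m x) \<partial>M)"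
    using split by (intro integral_cong_AE) (use meas in auto)
  also have "\<dots> = (\<integral>x. enn2real (?p x) \<partial>M) - (\<integral>x. enn2real (?m x) \<partial>M)"
    using ip im by simp
  also have "\<dots> = enn2real (\<integral>\<^sup>+x. ?p x \<partial>M) - enn2real (\<integral>\<^sup>+x. ?m x \<partial>M)"
    using nn_integral_cong_AE[OF eqp] nn_integral_cong_AE[OF eqm]
    by (simp add: integral_eq_nn_integral)
  also have "\<dots> = (\<integral>y. f y \<partial>(M \<bind> N))"
    using f p m by (simp add: real_lebesgue_integral_def)
  finally show "(\<integral>y. f y \<partial>(M \<bind> N)) = (\<integral>x. (\<integral>y. f y \<partial>N x) \<partial>M)" ..
qed

section \<open>Square-integrable functions\<close>

lemma square_integrableD:
  assumes "f \<in> square_integrable \<pi>"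
  shows "f \<in> borel_measurable \<pi>" "integrable \<pi> (\<lambda>z. (f z)\<^sup>2)"
  using assms by (auto simp: square_integrable_def)

lemma integrable_mult_square_integrable:
  assumes f: "f \<in> square_integrable \<pi>" and g: "g \<in> square_integrable \<pi>"
  shows "integrable \<pi> (\<lambda>z. f z * g z)"
proof (rule Bochner_Integration.integrable_bound)
  show "integrable \<pi> (\<lambda>z. (f z)\<^sup>2 + (g z)\<^sup>2)"
    using f g by (simp add: square_integrable_def)
  show "(\<lambda>z. f z * g z) \<in> borel_measurable \<pi>"
    using square_integrableD(1)[OF f] square_integrableD(1)[OF g] by measurable
  show "AE z in \<pi>. norm (f z * g z) \<le> norm ((f z)\<^sup>2 + (g z)\<^sup>2)"
  proof (rule AE_I2)
    fix z
    have "0 \<le> (\<bar>f z\<bar> - \<bar>g z\<bar>)\<^sup>2" by simp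
    then have "2 * (\<bar>f z\<bar> * \<bar>g z\<bar>) \<le> (f z)\<^sup>2 + (g z)\<^sup>2"
      by (simp add: power2_diff)
    moreover have "0 \<le> \<bar>f z\<bar> * \<bar>g z\<bar>" by (rule mult_nonneg_nonneg) auto
    ultimately have "\<bar>f z\<bar> * \<bar>g z\<bar> \<le> (f z)\<^sup>2 + (g z)\<^sup>2" by linarith
    then show "norm (f z * g z) \<le> norm ((f z)\<^sup>2 + (g z)\<^sup>2)"
      by (simp add: abs_mult)
  qed
qed

lemma square_integrable_add[intro]:
  assumes f: "f \<in> square_integrable \<pi>" and g: "g \<in> square_integrable \<pi>"
  shows "(\<lambda>z. f z + g z) \<in> square_integrable \<pi>"
  using f g integrable_mult_square_integrable[OF f g]
  by (auto simp: square_integrable_def power2_sum mult.assoc)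

lemma square_integrable_cmult[intro]:
  "f \<in> square_integrable \<pi> \<Longrightarrow> (\<lambda>z. c * f z) \<in> square_integrable \<pi>"
  by (auto simp: square_integrable_def power_mult_distrib)

lemma square_integrable_diff[intro]:
  assumes f: "f \<in> square_integrable \<pi>" and g: "g \<in> square_integrable \<pi>"
  shows "(\<lambda>z. f z - g z) \<in> square_integrable \<pi>"
  using square_integrable_add[OF f square_integrable_cmult[OF g, of "-1"]] by simp

lemma square_integrable_bounded_mult:
  assumes f: "f \<in> square_integrable \<pi>" and r[measurable]: "r \<in> borel_measurable \<pi>"
    and b: "\<And>z. z \<in> space \<pi> \<Longrightarrow> \<bar>r z\<bar> \<le> b"
  shows "(\<lambda>z. r z * f z) \<in> square_integrable \<pi>"
proof -
  have [measurable]: "f \<in> borel_measurable \<pi>" by (rule square_integrableD[OF f])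
  have "integrable \<pi> (\<lambda>z. (r z * f z)\<^sup>2)"
  proof (rule Bochner_Integration.integrable_bound)
    show "integrable \<pi> (\<lambda>z. b\<^sup>2 * (f z)\<^sup>2)" using square_integrableD[OF f] by simp
    show "AE z in \<pi>. norm ((r z * f z)\<^sup>2) \<le> norm (b\<^sup>2 * (f z)\<^sup>2)"
      using AE_space
    proof eventually_elim
      case (elim z)
      have "(r z)\<^sup>2 \<le> b\<^sup>2" using b[OF elim] power_mono[of "\<bar>r z\<bar>" b 2] by simp
      then show ?case by (simp add: power_mult_distrib mult_right_mono)
    qed
  qed measurable
  then show ?thesis by (simp add: square_integrable_def)
qed

lemma square_integrable_pos_part:
  assumes f: "f \<in> square_integrable \<pi>"
  shows "(\<lambda>z. max 0 (f z)) \<in> square_integrable \<pi>"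
proof -
  have [measurable]: "f \<in> borel_measurable \<pi>" by (rule square_integrableD[OF f])
  have "integrable \<pi> (\<lambda>z. (max 0 (f z))\<^sup>2)"
    by (rule Bochner_Integration.integrable_bound[OF square_integrableD(2)[OF f]])
       (auto simp: max_def)
  then show ?thesis by (simp add: square_integrable_def)
qed

lemma integral_square_add_le:
  assumes f: "f \<in> square_integrable \<pi>" and g: "g \<in> square_integrable \<pi>"
  shows "(\<integral>z. (f z + g z)\<^sup>2 \<partial>\<pi>) \<le> 2 * (\<integral>z. (f z)\<^sup>2 \<partial>\<pi>) + 2 * (\<integral>z. (g z)\<^sup>2 \<partial>\<pi>)"
proof -
  have "(\<integral>z. (f z + g z)\<^sup>2 \<partial>\<pi>) \<le> (\<integral>z. 2 * (f z)\<^sup>2 + 2 * (g z)\<^sup>2 \<partial>\<pi>)"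
  proof (rule integral_mono)
    show "integrable \<pi> (\<lambda>z. (f z + g z)\<^sup>2)"
      by (rule square_integrableD[OF square_integrable_add[OF f g]])
    show "integrable \<pi> (\<lambda>z. 2 * (f z)\<^sup>2 + 2 * (g z)\<^sup>2)"
      using square_integrableD[OF f] square_integrableD[OF g] by simp
    show "(f z + g z)\<^sup>2 \<le> 2 * (f z)\<^sup>2 + 2 * (g z)\<^sup>2" for z
      using zero_le_power2[of "f z - g z"] unfolding power2_sum power2_diff by linarith
  qed
  also have "\<dots> = 2 * (\<integral>z. (f z)\<^sup>2 \<partial>\<pi>) + 2 * (\<integral>z. (g z)\<^sup>2 \<partial>\<pi>)"
    using square_integrableD[OF f] square_integrableD[OF g] by simp
  finally show ?thesis .
qed

lemma L2_norm_le_iff: "0 \<le> C \<Longrightarrow> L2_norm \<pi> f \<le> C * L2_norm \<pi> g \<longleftrightarrow>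
    (\<integral>z. (f z)\<^sup>2 \<partial>\<pi>) \<le> C\<^sup>2 * (\<integral>z. (g z)\<^sup>2 \<partial>\<pi>)"
proof -
  assume "0 \<le> C"
  then have "C * L2_norm \<pi> g = sqrt (C\<^sup>2 * (\<integral>z. (g z)\<^sup>2 \<partial>\<pi>))"
    by (simp add: L2_norm_def real_sqrt_mult)
  then show ?thesis by (simp add: L2_norm_def)
qed

context prob_space begin

lemma integrable_square_integrable:
  assumes f: "f \<in> square_integrable M"
  shows "integrable M f"
proof -
  have "(\<lambda>z. 1) \<in> square_integrable M" by (simp add: square_integrable_def)
  from integrable_mult_square_integrable[OF f this] show ?thesis by simp
qed

lemma square_integral_le:
  assumes f: "f \<in> square_integrable M"
  shows "(\<integral>z. f z \<partial>M)\<^sup>2 \<le> (\<integral>z. (f z)\<^sup>2 \<partial>M)"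
  using variance_eq[OF integrable_square_integrable[OF f] square_integrableD(2)[OF f]]
    variance_positive[of f] by linarith

lemma square_integrable_const: "(\<lambda>z. c) \<in> square_integrable M"
  by (simp add: square_integrable_def)

end

section \<open>Invariant kernels as contractions\<close>

text \<open>
  Invariance alone makes the operator of a kernel well defined on classes of functions modulo null sets and
  a contraction of \<open>L\<^sup>2(\<pi>)\<close>.  The chain law, the autocovariances and the bound on the spectrum are
  available at this generality; reversibility enters only afterwards.
\<close>

locale invariant_kernel = prob_space \<pi> for \<pi> :: "'z measure" +
  fixes K :: "'z \<Rightarrow> 'z measure"
  assumes kernel: "K \<in> \<pi> \<rightarrow>\<^sub>M prob_algebra \<pi>"
    and invariant: "\<pi> \<bind> K = \<pi>"
begin

lemma kernel_sub[measurable]: "K \<in> \<pi> \<rightarrow>\<^sub>M subprob_algebra \<pi>"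
  by (rule measurable_prob_algebraD[OF kernel])

lemma prob_space_kernel: "z \<in> space \<pi> \<Longrightarrow> prob_space (K z)"
  using measurable_space[OF kernel] by (auto simp: space_prob_algebra)

lemma sets_K: "z \<in> space \<pi> \<Longrightarrow> sets (K z) = sets \<pi>"
  using sets_kernel[OF kernel_sub] .

lemma space_K: "z \<in> space \<pi> \<Longrightarrow> space (K z) = space \<pi>"
  using sets_K sets_eq_imp_space_eq by blast

lemma nn_integral_invariant:
  "f \<in> borel_measurable \<pi> \<Longrightarrow> (\<integral>\<^sup>+z. (\<integral>\<^sup>+w. f w \<partial>K z) \<partial>\<pi>) = (\<integral>\<^sup>+z. f z \<partial>\<pi>)"
  using nn_integral_bind[OF _ kernel_sub, of f] by (simp add: invariant)

text \<open>
  The invariance of \<open>\<pi>\<close> is what turns a \<open>\<pi>\<close>-null set into a null set for almost every transition measure; it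
  justifies changing functions on null sets before the operator is applied.
\<close>

lemma AE_kernel:
  assumes "AE z in \<pi>. P z"
  shows "AE z in \<pi>. AE w in K z. P w"
proof -
  from assms obtain N where N: "{z\<in>space \<pi>. \<not> P z} \<subseteq> N" "emeasure \<pi> N = 0" "N \<in> sets \<pi>"
    by (rule AE_E)
  have "AE z in \<pi>. z \<notin> N" using N by (intro AE_not_in) auto
  then have "AE z in \<pi> \<bind> K. z \<notin> N" by (subst invariant)
  moreover have "Measurable.pred \<pi> (\<lambda>z. z \<notin> N)" using N by measurable
  ultimately have "AE z in \<pi>. AE w in K z. w \<notin> N"
    by (simp add: AE_bind[OF kernel_sub])
  then show ?thesis using AE_space
  proof eventually_elim
    case (elim z)
    from elim(1) AE_space[of "K z"] show ?case
      by eventually_elim (use N space_K[OF elim(2)] in auto)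
  qed
qed

lemma kernel_op_measurable[measurable]:
  "f \<in> borel_measurable \<pi> \<Longrightarrow> kernel_op K f \<in> borel_measurable \<pi>"
  unfolding kernel_op_def[abs_def]
  using measurable_compose[OF kernel_sub integral_measurable_subprob_algebra] .

lemma AE_integrable_kernel: "integrable \<pi> f \<Longrightarrow> AE z in \<pi>. integrable (K z) f"
  for f :: "'z \<Rightarrow> real"
  using AE_integrable_bind[OF kernel_sub not_empty, of f] by (simp add: invariant)

lemma integrable_kernel_op: "integrable \<pi> f \<Longrightarrow> integrable \<pi> (kernel_op K f)"
  using integrable_integral_bind[OF kernel_sub not_empty, of f]
  by (simp add: invariant kernel_op_def[abs_def])

lemma integral_kernel_op: "integrable \<pi> f \<Longrightarrow> (\<integral>z. kernel_op K f z \<partial>\<pi>) = (\<integral>z. f z \<partial>\<pi>)"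
  using integral_bind_integrable[OF kernel_sub not_empty, of f]
  by (simp add: invariant kernel_op_def)

lemma kernel_op_cong_AE:
  assumes [measurable]: "f \<in> borel_measurable \<pi>" "g \<in> borel_measurable \<pi>"
    and "AE z in \<pi>. f z = g z"
  shows "AE z in \<pi>. kernel_op K f z = kernel_op K g z"
  using AE_kernel[OF assms(3)] AE_space
proof eventually_elim
  case (elim z)
  then show ?case unfolding kernel_op_def
    using assms by (intro integral_cong_AE) (auto simp: measurable_cong_sets[OF sets_K refl])
qed

lemma kernel_op_add:
  assumes "integrable \<pi> f" "integrable \<pi> g"
  shows "AE z in \<pi>. kernel_op K (\<lambda>w. f w + g w) z = kernel_op K f z + kernel_op K g z"
  using AE_integrable_kernel[OF assms(1)] AE_integrable_kernel[OF assms(2)]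
  by eventually_elim (simp add: kernel_op_def)

lemma kernel_op_diff:
  assumes "integrable \<pi> f" "integrable \<pi> g"
  shows "AE z in \<pi>. kernel_op K (\<lambda>w. f w - g w) z = kernel_op K f z - kernel_op K g z"
  using AE_integrable_kernel[OF assms(1)] AE_integrable_kernel[OF assms(2)]
  by eventually_elim (simp add: kernel_op_def)

lemma kernel_op_cmult: "kernel_op K (\<lambda>w. c * f w) z = c * kernel_op K f z"
  by (simp add: kernel_op_def)

text \<open>
  Jensen's inequality for the square, applied to each transition measure for which the square is integrable.
\<close>

lemma square_kernel_op_le:
  assumes f: "f \<in> square_integrable \<pi>"
  shows "AE z in \<pi>. (kernel_op K f z)\<^sup>2 \<le> kernel_op K (\<lambda>w. (f w)\<^sup>2) z"
  using AE_integrable_kernel[OF square_integrableD(2)[OF f]] AE_space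
proof eventually_elim
  case (elim z)
  interpret Kz: prob_space "K z" by (rule prob_space_kernel[OF elim(2)])
  have "f \<in> square_integrable (K z)"
    using elim square_integrableD[OF f]
    by (simp add: square_integrable_def measurable_cong_sets[OF sets_K[OF elim(2)] refl])
  from Kz.square_integral_le[OF this] show ?case by (simp add: kernel_op_def)
qed

lemma
  assumes f: "f \<in> square_integrable \<pi>"
  shows square_integrable_kernel_op: "kernel_op K f \<in> square_integrable \<pi>"
    and integral_square_kernel_op_le:
      "(\<integral>z. (kernel_op K f z)\<^sup>2 \<partial>\<pi>) \<le> (\<integral>z. (f z)\<^sup>2 \<partial>\<pi>)"
proof -
  have [measurable]: "f \<in> borel_measurable \<pi>" by (rule square_integrableD[OF f])
  note f2 = square_integrableD(2)[OF f]
  have int: "integrable \<pi> (\<lambda>z. (kernel_op K f z)\<^sup>2)"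
  proof (rule Bochner_Integration.integrable_bound[OF integrable_kernel_op[OF f2]])
    show "AE z in \<pi>. norm ((kernel_op K f z)\<^sup>2) \<le> norm (kernel_op K (\<lambda>w. (f w)\<^sup>2) z)"
      using square_kernel_op_le[OF f] by eventually_elim simp
  qed measurable
  then show "kernel_op K f \<in> square_integrable \<pi>"
    by (simp add: square_integrable_def)
  show "(\<integral>z. (kernel_op K f z)\<^sup>2 \<partial>\<pi>) \<le> (\<integral>z. (f z)\<^sup>2 \<partial>\<pi>)"
    using integral_mono_AE[OF int integrable_kernel_op[OF f2] square_kernel_op_le[OF f]]
    by (simp add: integral_kernel_op[OF f2])
qed

lemma kernel_op_funpow_square_integrable:
  "f \<in> square_integrable \<pi> \<Longrightarrow> (kernel_op K ^^ n) f \<in> square_integrable \<pi>"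
  by (induction n) (auto intro: square_integrable_kernel_op)

lemma kernel_op_mean_zero: "f \<in> mean_zero \<pi> \<Longrightarrow> kernel_op K f \<in> mean_zero \<pi>"
  by (auto simp: mean_zero_def square_integrable_kernel_op integral_kernel_op integrable_square_integrable)

end

text \<open>
  For nonnegative functions this identity holds everywhere.  A signed function need not be integrable for every
  transition measure, and the Bochner integral takes a default value where it is not, which is why the identity
  is only claimed almost everywhere.
\<close>

lemma composed_kernel_op:
  assumes L: "invariant_kernel \<pi> L" and K: "invariant_kernel \<pi> K" and M: "invariant_kernel \<pi> M"
    and comp: "\<And>z. z \<in> space \<pi> \<Longrightarrow> L z \<bind> K = M z"
    and f: "integrable \<pi> f"
  shows "AE z in \<pi>. kernel_op M f z = kernel_op L (kernel_op K f) z"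
proof -
  interpret L: invariant_kernel \<pi> L by fact
  interpret K: invariant_kernel \<pi> K by fact
  interpret M: invariant_kernel \<pi> M by fact
  show ?thesis
    using M.AE_integrable_kernel[OF f] AE_space
  proof eventually_elim
    case (elim z)
    have "K \<in> L z \<rightarrow>\<^sub>M subprob_algebra \<pi>"
      using K.kernel_sub by (simp add: measurable_cong_sets[OF L.sets_K[OF elim(2)] refl])
    then show ?case
      unfolding kernel_op_def
      using integral_bind_integrable[of K "L z" \<pi> f] elim L.space_K[OF elim(2)] L.not_empty
      by (simp add: comp)
  qed
qed

section \<open>Reversible kernels as self-adjoint operators\<close>

text \<open>
  Reversibility is stated for nonnegative functions, for which no integrability has to be discussed: this form is
  the convenient one to verify for a concrete kernel.  The signed, square-integrable form is
  \<open>kernel_op_symmetric\<close>.  The choice \<open>u = 1\<close> gives invariance.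
\<close>

locale reversible_kernel = prob_space \<pi> for \<pi> :: "'z measure" +
  fixes K :: "'z \<Rightarrow> 'z measure"
  assumes kernel_rev: "K \<in> \<pi> \<rightarrow>\<^sub>M prob_algebra \<pi>"
    and reversible: "\<And>u v :: 'z \<Rightarrow> ennreal. u \<in> borel_measurable \<pi> \<Longrightarrow> v \<in> borel_measurable \<pi> \<Longrightarrow>
      (\<integral>\<^sup>+z. u z * (\<integral>\<^sup>+w. v w \<partial>K z) \<partial>\<pi>) = (\<integral>\<^sup>+z. v z * (\<integral>\<^sup>+w. u w \<partial>K z) \<partial>\<pi>)"

sublocale reversible_kernel \<subseteq> invariant_kernel
proof
  show "K \<in> \<pi> \<rightarrow>\<^sub>M prob_algebra \<pi>" by (rule kernel_rev)
  have sub: "K \<in> \<pi> \<rightarrow>\<^sub>M subprob_algebra \<pi>" by (rule measurable_prob_algebraD[OF kernel_rev])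
  show "\<pi> \<bind> K = \<pi>"
  proof (rule measure_eqI)
    show "sets (\<pi> \<bind> K) = sets \<pi>" by (rule sets_bind[OF sets_kernel[OF sub] not_empty])
    then show "emeasure (\<pi> \<bind> K) A = emeasure \<pi> A" if "A \<in> sets (\<pi> \<bind> K)" for A
    proof -
      have A: "A \<in> sets \<pi>" using that \<open>sets (\<pi> \<bind> K) = sets \<pi>\<close> by simp
      have K1: "emeasure (K z) (space \<pi>) = 1" if "z \<in> space \<pi>" for z
        using measurable_space[OF kernel_rev that] sets_eq_imp_space_eq[OF sets_kernel[OF sub that]]
          prob_space.emeasure_space_1[of "K z"] by (simp add: space_prob_algebra)
      have "emeasure (\<pi> \<bind> K) A = (\<integral>\<^sup>+z. emeasure (K z) A \<partial>\<pi>)"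
        by (rule emeasure_bind[OF not_empty sub A])
      also have "\<dots> = (\<integral>\<^sup>+z. 1 * (\<integral>\<^sup>+w. indicator A w \<partial>K z) \<partial>\<pi>)"
        using A by (intro nn_integral_cong) (simp add: sets_kernel[OF sub])
      also have "\<dots> = (\<integral>\<^sup>+z. indicator A z * (\<integral>\<^sup>+w. 1 \<partial>K z) \<partial>\<pi>)"
        using A by (intro reversible) auto
      also have "\<dots> = (\<integral>\<^sup>+z. indicator A z \<partial>\<pi>)"
        using K1 by (intro nn_integral_cong) (simp add: sets_eq_imp_space_eq[OF sets_kernel[OF sub]])
      also have "\<dots> = emeasure \<pi> A" using A by simp
      finally show ?thesis .
    qed
  qed
qed

context reversible_kernel begin

lemma kernel_op_nonneg_symmetric:
  assumes u: "u \<in> square_integrable \<pi>" "\<And>z. 0 \<le> u z" and v: "v \<in> square_integrable \<pi>" "\<And>z. 0 \<le> v z"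
  shows "(\<integral>z. u z * kernel_op K v z \<partial>\<pi>) = (\<integral>z. v z * kernel_op K u z \<partial>\<pi>)"
proof -
  have *: "(\<integral>z. u z * kernel_op K v z \<partial>\<pi>) =
      enn2real (\<integral>\<^sup>+z. ennreal (u z) * (\<integral>\<^sup>+w. ennreal (v w) \<partial>K z) \<partial>\<pi>)"
    if u: "u \<in> square_integrable \<pi>" "\<And>z. 0 \<le> u z" and v: "v \<in> square_integrable \<pi>" "\<And>z. 0 \<le> v z" for u v
  proof -
    have nn: "0 \<le> kernel_op K v z" for z using v(2) by (simp add: kernel_op_def)
    have [measurable]: "u \<in> borel_measurable \<pi>" "v \<in> borel_measurable \<pi>"
      using u v by (auto simp: square_integrable_def)
    have "(\<integral>z. u z * kernel_op K v z \<partial>\<pi>) = enn2real (\<integral>\<^sup>+z. ennreal (u z * kernel_op K v z) \<partial>\<pi>)"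
      by (rule integral_eq_nn_integral) (auto simp: u nn)
    also have "(\<integral>\<^sup>+z. ennreal (u z * kernel_op K v z) \<partial>\<pi>) =
        (\<integral>\<^sup>+z. ennreal (u z) * (\<integral>\<^sup>+w. ennreal (v w) \<partial>K z) \<partial>\<pi>)"
    proof (rule nn_integral_cong_AE)
      show "AE z in \<pi>. ennreal (u z * kernel_op K v z) = ennreal (u z) * (\<integral>\<^sup>+w. ennreal (v w) \<partial>K z)"
        using AE_integrable_kernel[OF integrable_square_integrable[OF v(1)]]
        by eventually_elim (use u v in \<open>simp add: ennreal_mult kernel_op_def nn_integral_eq_integral\<close>)
    qed
    finally show ?thesis .
  qed
  show ?thesis
    unfolding *[OF u v] *[OF v u] using u v
    by (subst reversible) (auto simp: square_integrable_def)
qed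

text \<open>
  Both sides are bilinear, so splitting \<open>f\<close> and \<open>g\<close> into positive and negative parts reduces the claim to
  nonnegative functions, where it is reversibility.
\<close>

theorem kernel_op_symmetric:
  assumes f: "f \<in> square_integrable \<pi>" and g: "g \<in> square_integrable \<pi>"
  shows "(\<integral>z. f z * kernel_op K g z \<partial>\<pi>) = (\<integral>z. g z * kernel_op K f z \<partial>\<pi>)"
proof -
  define p where "p f z = max 0 (f z)" for f :: "'z \<Rightarrow> real" and z
  define n where "n f z = max 0 (- f z)" for f :: "'z \<Rightarrow> real" and z
  have pn: "f z = p f z - n f z" for f z by (auto simp: p_def n_def)
  have nn: "0 \<le> p f z" "0 \<le> n f z" for f z by (auto simp: p_def n_def)
  have si: "p f \<in> square_integrable \<pi>" "n f \<in> square_integrable \<pi>"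
    if "f \<in> square_integrable \<pi>" for f
    using square_integrable_pos_part[OF that] square_integrable_pos_part[OF square_integrable_cmult[OF that, of "-1"]]
    by (simp_all add: p_def[abs_def] n_def[abs_def])
  let ?I = "\<lambda>u v. \<integral>z. u z * kernel_op K v z \<partial>\<pi>"
  have expand: "?I f g = ?I (p f) (p g) - ?I (p f) (n g) - ?I (n f) (p g) + ?I (n f) (n g)"
    if f: "f \<in> square_integrable \<pi>" and g: "g \<in> square_integrable \<pi>" for f g
  proof -
    have [measurable]: "f \<in> borel_measurable \<pi>" "g \<in> borel_measurable \<pi>"
       "p f \<in> borel_measurable \<pi>" "p g \<in> borel_measurable \<pi>" "n f \<in> borel_measurable \<pi>" "n g \<in> borel_measurable \<pi>"
      using f g si[OF f] si[OF g] by (auto simp: square_integrable_def)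
    have I: "integrable \<pi> (\<lambda>z. u z * kernel_op K v z)" if "u \<in> square_integrable \<pi>" "v \<in> square_integrable \<pi>" for u v
      using that by (intro integrable_mult_square_integrable square_integrable_kernel_op)
    have "AE z in \<pi>. kernel_op K g z = kernel_op K (p g) z - kernel_op K (n g) z"
      using kernel_op_diff[OF integrable_square_integrable[OF si(1)[OF g]] integrable_square_integrable[OF si(2)[OF g]]]
      by (simp flip: pn)
    then have "AE z in \<pi>. f z * kernel_op K g z =
       p f z * kernel_op K (p g) z - p f z * kernel_op K (n g) z - n f z * kernel_op K (p g) z + n f z * kernel_op K (n g) z"
    proof eventually_elim
      case (elim z)
      show ?case unfolding elim pn[of f z] by (simp add: left_diff_distrib right_diff_distrib)
    qed
    then have "?I f g = (\<integral>z. p f z * kernel_op K (p g) z - p f z * kernel_op K (n g) z - n f z * kernel_op K (p g) z + n f z * kernel_op K (n g) z \<partial>\<pi>)"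
      by (rule integral_cong_AE[rotated 2]) measurable
    also have "\<dots> = ?I (p f) (p g) - ?I (p f) (n g) - ?I (n f) (p g) + ?I (n f) (n g)"
      by (simp add: I si[OF f] si[OF g])
    finally show ?thesis .
  qed
  show ?thesis
    unfolding expand[OF f g] expand[OF g f]
    using kernel_op_nonneg_symmetric[OF si(1)[OF f] nn(1) si(1)[OF g] nn(1)]
      kernel_op_nonneg_symmetric[OF si(1)[OF f] nn(1) si(2)[OF g] nn(2)]
      kernel_op_nonneg_symmetric[OF si(2)[OF f] nn(2) si(1)[OF g] nn(1)]
      kernel_op_nonneg_symmetric[OF si(2)[OF f] nn(2) si(2)[OF g] nn(2)]
    by linarith
qed

end

section \<open>Autocovariances of the stationary chain\<close>

text \<open>
  The distance of two time points.  A plain difference of natural numbers would be zero when \<open>s < t\<close>.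
\<close>

definition lag :: "nat \<Rightarrow> nat \<Rightarrow> nat" where
  "lag s t = (if s \<le> t then t - s else s - t)"

context invariant_kernel
begin

text \<open>
  The chain law is built by the Ionescu-Tulcea extension from one-step kernels that may look at the whole past.
  Here the step at time zero ignores the past and draws from \<open>\<pi>\<close>; every later step looks at the last state only.
\<close>

lemma chain_step_measurable:
  "chain_step \<pi> K i \<in> PiM {0..<i} (\<lambda>_. \<pi>) \<rightarrow>\<^sub>M subprob_algebra \<pi>"
proof (cases i)
  case 0
  have "chain_step \<pi> K 0 = (\<lambda>_. \<pi>)" by (simp add: chain_step_def fun_eq_iff)
  then show ?thesis using 0 M_in_subprob by simp
next
  case (Suc s)
  have "chain_step \<pi> K (Suc s) = (\<lambda>\<omega>. K (\<omega> s))" by (simp add: chain_step_def fun_eq_iff)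
  moreover have "(\<lambda>\<omega>. K (\<omega> s)) \<in> PiM {0..<Suc s} (\<lambda>_. \<pi>) \<rightarrow>\<^sub>M subprob_algebra \<pi>"
    by (rule measurable_compose[OF _ kernel_sub], rule measurable_component_singleton) simp
  ultimately show ?thesis using Suc by simp
qed

lemma Ionescu_Tulcea_chain: "Ionescu_Tulcea (chain_step \<pi> K) (\<lambda>_. \<pi>)"
proof (rule Ionescu_Tulcea.intro)
  show "prob_space (chain_step \<pi> K i \<omega>)"
    if "\<omega> \<in> space (PiM {0..<i} (\<lambda>_. \<pi>))" for i \<omega>
    using that prob_space_axioms prob_space_kernel
    by (auto simp: chain_step_def space_PiM PiE_iff split: nat.split)
qed (rule chain_step_measurable)

sublocale IT: Ionescu_Tulcea "chain_step \<pi> K" "\<lambda>_. \<pi>"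
  by (rule Ionescu_Tulcea_chain)

text \<open>
  The joint law of the first \<open>n\<close> states, constructed by attaching one state after another; this recursion is what
  the proofs of stationarity and of the Markov property use.
\<close>

abbreviation history :: "nat \<Rightarrow> (nat \<Rightarrow> 'z) measure" where
  "history n \<equiv> IT.C 0 n (\<lambda>_. undefined)"

lemma sets_chain_law: "sets (chain_law \<pi> K) = sets (PiM UNIV (\<lambda>_. \<pi>))"
  by (simp add: chain_law_def)

lemma measurable_chain_coordinate[measurable]: "(\<lambda>\<omega>. \<omega> t) \<in> chain_law \<pi> K \<rightarrow>\<^sub>M \<pi>"
  unfolding measurable_cong_sets[OF sets_chain_law refl]
  by (rule measurable_component_singleton) simp

lemma sets_history: "sets (history n) = sets (PiM {0..<n} (\<lambda>_. \<pi>))"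
  using IT.sets_C[of "\<lambda>_. undefined" 0 n] by simp

lemma prob_space_history: "prob_space (history n)"
  by (rule IT.prob_space_C) simp

lemma distr_chain_law_history:
  "distr (chain_law \<pi> K) (PiM {0..<n} (\<lambda>_. \<pi>)) (\<lambda>\<omega>. restrict \<omega> {0..<n}) = history n"
proof -
  have "IT.up_to {0..<n} = n"
    using IT.up_to_iff[of "{0..<n}" n] IT.up_to_less[of "{0..<n}" "n - 1"]
    by (cases n) auto
  then have "IT.CI {0..<n} = history n"
    unfolding IT.CI_def using IT.distr_C[of n n "\<lambda>_. undefined" 0] by simp
  then show ?thesis
    unfolding chain_law_def by (subst IT.distr_lim) auto
qed

lemma measurable_history_coordinate:
  "s < n \<Longrightarrow> (\<lambda>\<omega>. \<omega> s) \<in> PiM {0..<n} (\<lambda>_. \<pi>) \<rightarrow>\<^sub>M \<pi>"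
  for s n :: nat
  by (rule measurable_component_singleton) simp

lemma measurable_restrict_chain:
  "(\<lambda>\<omega>. restrict \<omega> {0..<n}) \<in> chain_law \<pi> K \<rightarrow>\<^sub>M PiM {0..<n} (\<lambda>_. \<pi>)"
  unfolding measurable_cong_sets[OF sets_chain_law refl]
  by (rule measurable_restrict_subset) simp

text \<open>
  Stationarity: the law of the state at time \<open>t + 1\<close> is the law at time \<open>t\<close> composed with the kernel.
\<close>

lemma distr_chain_coordinate: "distr (chain_law \<pi> K) \<pi> (\<lambda>\<omega>. \<omega> t) = \<pi>"
proof -
  have dh: "distr (chain_law \<pi> K) \<pi> (\<lambda>\<omega>. \<omega> t) = distr (history (Suc t)) \<pi> (\<lambda>\<omega>. \<omega> t)" for t
    unfolding distr_chain_law_history[symmetric]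
    by (subst distr_distr[OF measurable_history_coordinate measurable_restrict_chain])
       (auto simp: comp_def)
  have step: "distr (history (Suc t)) \<pi> (\<lambda>\<omega>. \<omega> t) = history t \<bind> chain_step \<pi> K t" for t
  proof -
    have ne: "space (history t) \<noteq> {}" by (rule prob_space.not_empty[OF prob_space_history])
    have eP: "IT.eP t \<in> history t \<rightarrow>\<^sub>M subprob_algebra (PiM {0..<Suc t} (\<lambda>_. \<pi>))"
      using IT.measurable_eP[of t] by (simp add: measurable_cong_sets[OF sets_history refl])
    have "distr (history (Suc t)) \<pi> (\<lambda>\<omega>. \<omega> t) =
        history t \<bind> (\<lambda>\<omega>. distr (IT.eP t \<omega>) \<pi> (\<lambda>\<omega>. \<omega> t))"
      using distr_bind[OF eP ne measurable_history_coordinate[of t "Suc t"]] by simp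
    also have "\<dots> = history t \<bind> chain_step \<pi> K t"
    proof (rule bind_cong[OF refl])
      fix \<omega> assume "\<omega> \<in> space (history t)"
      then have \<omega>: "\<omega> \<in> space (PiM {0..<t} (\<lambda>_. \<pi>))"
        by (simp add: sets_eq_imp_space_eq[OF sets_history])
      have sets_step: "sets (chain_step \<pi> K t \<omega>) = sets \<pi>" by (rule IT.sets_P[OF \<omega>])
      have upd: "fun_upd \<omega> t \<in> chain_step \<pi> K t \<omega> \<rightarrow>\<^sub>M PiM {0..<Suc t} (\<lambda>_. \<pi>)"
        unfolding measurable_cong_sets[OF sets_step refl]
        using \<omega> by (intro measurable_fun_upd[where J="{0..<t}"]) auto
      show "distr (IT.eP t \<omega>) \<pi> (\<lambda>\<omega>. \<omega> t) = chain_step \<pi> K t \<omega>"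
        unfolding IT.eP_def
        by (subst distr_distr[OF measurable_history_coordinate upd])
           (simp_all add: comp_def distr_id2[OF sets_step[symmetric]])
    qed
    finally show ?thesis .
  qed
  show ?thesis
  proof (induction t)
    case 0
    have "chain_step \<pi> K 0 = (\<lambda>_. \<pi>)" by (simp add: chain_step_def fun_eq_iff)
    then show ?case
      unfolding dh step
      using bind_const'[OF prob_space_history[of 0] prob_space_imp_subprob_space[OF prob_space_axioms]] by simp
  next
    case (Suc s)
    have "chain_step \<pi> K (Suc s) = (\<lambda>\<omega>. K (\<omega> s))" by (simp add: chain_step_def fun_eq_iff)
    then have "distr (chain_law \<pi> K) \<pi> (\<lambda>\<omega>. \<omega> (Suc s)) = history (Suc s) \<bind> (\<lambda>\<omega>. K (\<omega> s))"
      unfolding dh step by simp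
    also have "\<dots> = distr (history (Suc s)) \<pi> (\<lambda>\<omega>. \<omega> s) \<bind> K"
      using bind_distr[of "\<lambda>\<omega>. \<omega> s" "history (Suc s)" \<pi> K \<pi>] prob_space.not_empty[OF prob_space_history[of "Suc s"]]
        measurable_history_coordinate[of s "Suc s"] kernel_sub
      by (simp add: measurable_cong_sets[OF sets_history refl] del: IT.C.simps)
    also have "\<dots> = \<pi>" using Suc by (simp add: dh invariant del: IT.C.simps)
    finally show ?case .
  qed
qed

lemma
  assumes f: "f \<in> borel_measurable \<pi>"
  shows integrable_chain_coordinate:
      "integrable (chain_law \<pi> K) (\<lambda>\<omega>. f (\<omega> t) :: real) \<longleftrightarrow> integrable \<pi> f"
    and integral_chain_coordinate: "(\<integral>\<omega>. f (\<omega> t) \<partial>chain_law \<pi> K) = (\<integral>z. f z \<partial>\<pi>)"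
  using integrable_distr_eq[OF measurable_chain_coordinate[of t] f]
    integral_distr[OF measurable_chain_coordinate[of t] f]
  by (simp_all add: distr_chain_coordinate)

lemma square_integrable_chain_coordinate:
  assumes f: "f \<in> square_integrable \<pi>"
  shows "(\<lambda>\<omega>. f (\<omega> t)) \<in> square_integrable (chain_law \<pi> K)"
proof -
  have fm: "f \<in> borel_measurable \<pi>" by (rule square_integrableD[OF f])
  have "(\<lambda>\<omega>. f (\<omega> t)) \<in> borel_measurable (chain_law \<pi> K)"
    by (rule measurable_compose[OF measurable_chain_coordinate fm])
  moreover have "(\<lambda>z. (f z)\<^sup>2) \<in> borel_measurable \<pi>" using fm by measurable
  ultimately show ?thesis
    using integrable_chain_coordinate[of "\<lambda>z. (f z)\<^sup>2" t] square_integrableD(2)[OF f]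
    by (simp add: square_integrable_def)
qed

text \<open>
  Conditioning on the first \<open>t + 1\<close> states replaces \<open>v\<close> at time \<open>t + 1\<close> by its conditional expectation, the
  operator applied to \<open>v\<close> at time \<open>t\<close>.  Square-integrability of both functions makes the product integrable, which
  allows integrating out the last state first.
\<close>

lemma chain_markov_property:
  assumes u: "u \<in> square_integrable \<pi>" and v: "v \<in> square_integrable \<pi>" and st: "s \<le> t"
  shows "(\<integral>\<omega>. u (\<omega> s) * v (\<omega> (Suc t)) \<partial>chain_law \<pi> K) =
    (\<integral>\<omega>. u (\<omega> s) * kernel_op K v (\<omega> t) \<partial>chain_law \<pi> K)"
proof -
  let ?n = "Suc t"
  note um[measurable] = square_integrableD(1)[OF u] and vm[measurable] = square_integrableD(1)[OF v]
  note coord = measurable_history_coordinate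
  have mF: "(\<lambda>\<omega>. u (\<omega> s) * v (\<omega> (Suc t))) \<in> borel_measurable (PiM {0..<Suc ?n} (\<lambda>_. \<pi>))"
    using measurable_compose[OF coord um, of s "Suc ?n"] measurable_compose[OF coord vm, of "Suc t" "Suc ?n"] st
    by (intro borel_measurable_times) auto
  have mG: "(\<lambda>\<omega>. u (\<omega> s) * kernel_op K v (\<omega> t)) \<in> borel_measurable (PiM {0..<?n} (\<lambda>_. \<pi>))"
    using measurable_compose[OF coord um, of s ?n]
      measurable_compose[OF coord kernel_op_measurable[OF vm], of t ?n] st
    by (intro borel_measurable_times) auto
  have eP: "IT.eP ?n \<in> history ?n \<rightarrow>\<^sub>M subprob_algebra (PiM {0..<Suc ?n} (\<lambda>_. \<pi>))"
    using IT.measurable_eP[of ?n] by (simp add: measurable_cong_sets[OF sets_history refl] del: IT.C.simps)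
  have hist: "history (Suc ?n) = history ?n \<bind> IT.eP ?n"
    using IT.C.simps(2)[of 0 ?n "\<lambda>_. undefined"] by (simp del: IT.C.simps)
  have int: "integrable (history (Suc ?n)) (\<lambda>\<omega>. u (\<omega> s) * v (\<omega> (Suc t)))"
    using integrable_mult_square_integrable[OF square_integrable_chain_coordinate[OF u, of s]
        square_integrable_chain_coordinate[OF v, of "Suc t"]] st
      integrable_distr_eq[OF measurable_restrict_chain mF]
    by (simp add: distr_chain_law_history del: IT.C.simps)
  have "(\<integral>\<omega>. u (\<omega> s) * v (\<omega> (Suc t)) \<partial>chain_law \<pi> K) =
      (\<integral>\<omega>. u (\<omega> s) * v (\<omega> (Suc t)) \<partial>history (Suc ?n))"
    using integral_distr[OF measurable_restrict_chain mF] st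
    by (simp add: distr_chain_law_history del: IT.C.simps)
  also have "\<dots> = (\<integral>\<omega>. (\<integral>\<omega>'. u (\<omega>' s) * v (\<omega>' (Suc t)) \<partial>IT.eP ?n \<omega>) \<partial>history ?n)"
    using integral_bind_integrable[OF eP prob_space.not_empty[OF prob_space_history]] int
    unfolding hist by blast
  also have "\<dots> = (\<integral>\<omega>. u (\<omega> s) * kernel_op K v (\<omega> t) \<partial>history ?n)"
  proof (rule Bochner_Integration.integral_cong[OF refl])
    fix \<omega> assume "\<omega> \<in> space (history ?n)"
    then have \<omega>: "\<omega> \<in> space (PiM {0..<?n} (\<lambda>_. \<pi>))"
      by (simp only: sets_eq_imp_space_eq[OF sets_history])
    have upd: "fun_upd \<omega> ?n \<in> chain_step \<pi> K ?n \<omega> \<rightarrow>\<^sub>M PiM {0..<Suc ?n} (\<lambda>_. \<pi>)"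
      unfolding measurable_cong_sets[OF IT.sets_P[OF \<omega>] refl]
      using \<omega> by (intro measurable_fun_upd[where J="{0..<?n}"]) auto
    have "(\<integral>\<omega>'. u (\<omega>' s) * v (\<omega>' (Suc t)) \<partial>IT.eP ?n \<omega>) =
        (\<integral>w. u (fun_upd \<omega> ?n w s) * v (fun_upd \<omega> ?n w (Suc t)) \<partial>chain_step \<pi> K ?n \<omega>)"
      unfolding IT.eP_def by (rule integral_distr[OF upd mF])
    also have "\<dots> = u (\<omega> s) * kernel_op K v (\<omega> t)"
      using st by (simp add: chain_step_def kernel_op_def)
    finally show "(\<integral>\<omega>'. u (\<omega>' s) * v (\<omega>' (Suc t)) \<partial>IT.eP ?n \<omega>) = u (\<omega> s) * kernel_op K v (\<omega> t)" .
  qed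
  also have "\<dots> = (\<integral>\<omega>. u (\<omega> s) * kernel_op K v (\<omega> t) \<partial>chain_law \<pi> K)"
    using integral_distr[OF measurable_restrict_chain mG] st
    by (simp add: distr_chain_law_history del: IT.C.simps)
  finally show ?thesis .
qed

definition autocov :: "('z \<Rightarrow> real) \<Rightarrow> nat \<Rightarrow> real" where
  "autocov g k = (\<integral>z. g z * (kernel_op K ^^ k) g z \<partial>\<pi>)"

lemma chain_lag_integral:
  assumes u: "u \<in> square_integrable \<pi>" and v: "v \<in> square_integrable \<pi>"
  shows "(\<integral>\<omega>. u (\<omega> s) * v (\<omega> (s + k)) \<partial>chain_law \<pi> K) = (\<integral>z. u z * (kernel_op K ^^ k) v z \<partial>\<pi>)"
  using v
proof (induction k arbitrary: v)
  case 0
  have "(\<lambda>z. u z * v z) \<in> borel_measurable \<pi>"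
    using square_integrableD(1)[OF u] square_integrableD(1)[OF 0] by measurable
  from integral_chain_coordinate[OF this, of s] show ?case by simp
next
  case (Suc k)
  have "(\<integral>\<omega>. u (\<omega> s) * v (\<omega> (s + Suc k)) \<partial>chain_law \<pi> K) =
      (\<integral>\<omega>. u (\<omega> s) * kernel_op K v (\<omega> (s + k)) \<partial>chain_law \<pi> K)"
    using chain_markov_property[OF u Suc.prems, of s "s + k"] by simp
  also have "\<dots> = (\<integral>z. u z * (kernel_op K ^^ Suc k) v z \<partial>\<pi>)"
    by (simp add: Suc.IH[OF square_integrable_kernel_op[OF Suc.prems]] funpow_Suc_right del: funpow.simps)
  finally show ?case .
qed

text \<open>
  After centring, the variance of the sum is a double sum of covariances, and by stationarity each depends on the
  lag only.
\<close>

lemma scaled_variance_eq_autocov_sum: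
  assumes f: "f \<in> square_integrable \<pi>" and T: "1 \<le> T"
  defines "g \<equiv> \<lambda>z. f z - (\<integral>w. f w \<partial>\<pi>)"
  shows "real T * variance_of (chain_law \<pi> K) (\<lambda>\<omega>. (1 / real T) * (\<Sum>t = 1..T. f (\<omega> t)))
    = (\<Sum>s = 1..T. \<Sum>t = 1..T. autocov g (lag s t)) / real T"
proof -
  have g: "g \<in> square_integrable \<pi>"
    unfolding g_def by (intro square_integrable_diff f square_integrable_const)
  have fm: "f \<in> borel_measurable \<pi>" by (rule square_integrableD[OF f])
  have If: "integrable (chain_law \<pi> K) (\<lambda>\<omega>. f (\<omega> t))" for t
    using integrable_chain_coordinate[OF fm] integrable_square_integrable[OF f] by simp
  have mean: "(\<integral>\<omega>. (1 / real T) * (\<Sum>t = 1..T. f (\<omega> t)) \<partial>chain_law \<pi> K) = (\<integral>w. f w \<partial>\<pi>)"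
    using T by (simp add: If integral_chain_coordinate[OF fm])
  have cov: "(\<integral>\<omega>. g (\<omega> s) * g (\<omega> t) \<partial>chain_law \<pi> K) = autocov g (lag s t)" for s t
    using chain_lag_integral[OF g g, of s "t - s"] chain_lag_integral[OF g g, of t "s - t"]
    by (auto simp: lag_def autocov_def mult.commute)
  have Ig: "integrable (chain_law \<pi> K) (\<lambda>\<omega>. g (\<omega> s) * g (\<omega> t))" for s t
    by (intro integrable_mult_square_integrable square_integrable_chain_coordinate g)
  have "variance_of (chain_law \<pi> K) (\<lambda>\<omega>. (1 / real T) * (\<Sum>t = 1..T. f (\<omega> t))) =
      (\<integral>\<omega>. (1 / real T)\<^sup>2 * (\<Sum>s = 1..T. \<Sum>t = 1..T. g (\<omega> s) * g (\<omega> t)) \<partial>chain_law \<pi> K)"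
    unfolding variance_of_def mean
  proof (rule Bochner_Integration.integral_cong[OF refl])
    fix \<omega>
    have "(1 / real T) * (\<Sum>t = 1..T. f (\<omega> t)) - (\<integral>w. f w \<partial>\<pi>) = (1 / real T) * (\<Sum>t = 1..T. g (\<omega> t))"
      using T by (simp add: g_def sum_subtractf field_simps)
    then show "((1 / real T) * (\<Sum>t = 1..T. f (\<omega> t)) - (\<integral>w. f w \<partial>\<pi>))\<^sup>2 =
        (1 / real T)\<^sup>2 * (\<Sum>s = 1..T. \<Sum>t = 1..T. g (\<omega> s) * g (\<omega> t))"
      by (simp add: power_mult_distrib power2_eq_square sum_product)
  qed
  also have "\<dots> = (1 / real T)\<^sup>2 * (\<Sum>s = 1..T. \<Sum>t = 1..T. autocov g (lag s t))"
    by (simp add: Ig cov)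
  finally show ?thesis
    using T by (simp add: power2_eq_square)
qed

end

section \<open>Existence of the asymptotic variance\<close>

text \<open>
  Going from \<open>T\<close> to \<open>T + 1\<close> adds one row and one column to the double sum, each of which is a partial sum of \<open>\<gamma>\<close>; the
  corner, counted twice, is \<open>\<gamma> 0\<close>.  So the scaled variance is a Cesaro mean of partial sums.
\<close>

lemma lag_sum_eq:
  fixes \<gamma> :: "nat \<Rightarrow> real"
  shows "(\<Sum>s = 1..T. \<Sum>t = 1..T. \<gamma> (lag s t)) = (\<Sum>n<T. 2 * (\<Sum>k\<le>n. \<gamma> k) - \<gamma> 0)"
proof (induction T)
  case (Suc T)
  have col: "(\<Sum>s = 1..T. \<gamma> (lag s (Suc T))) = (\<Sum>k\<le>T. \<gamma> k) - \<gamma> 0"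
  proof -
    have "(\<Sum>s = 1..T. \<gamma> (lag s (Suc T))) = (\<Sum>k = 1..T. \<gamma> k)"
      by (rule sum.reindex_bij_witness[of _ "\<lambda>k. Suc T - k" "\<lambda>s. Suc T - s"]) (auto simp: lag_def)
    also have "\<dots> = (\<Sum>k\<le>T. \<gamma> k) - \<gamma> 0"
      by (simp add: atMost_atLeast0 sum.atLeast_Suc_atMost)
    finally show ?thesis .
  qed
  have row: "(\<Sum>t = 1..T. \<gamma> (lag (Suc T) t)) = (\<Sum>s = 1..T. \<gamma> (lag s (Suc T)))"
    by (rule sum.cong) (auto simp: lag_def)
  have "lag (Suc T) (Suc T) = 0" by (simp add: lag_def)
  then show ?case
    using Suc row col by (simp add: sum.distrib)
qed simp

lemma mean_incseq:
  fixes a :: "nat \<Rightarrow> real"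
  assumes a: "incseq a"
  shows "incseq (\<lambda>n. (\<Sum>k<Suc n. a k) / real (Suc n))"
proof (rule incseq_SucI)
  fix n
  have "(\<Sum>k<Suc n. a k) \<le> (\<Sum>k<Suc n. a (Suc n))"
    by (intro sum_mono incseqD[OF a]) auto
  then have "(\<Sum>k<Suc n. a k) \<le> real (Suc n) * a (Suc n)" by simp
  then have "(\<Sum>k<Suc n. a k) * real (Suc (Suc n)) \<le> (\<Sum>k<Suc (Suc n). a k) * real (Suc n)"
    by (simp only: sum.lessThan_Suc[of _ "Suc n"]) (simp add: algebra_simps)
  then show "(\<Sum>k<Suc n. a k) / real (Suc n) \<le> (\<Sum>k<Suc (Suc n). a k) / real (Suc (Suc n))"
    by (simp only: divide_le_eq le_divide_eq of_nat_0_less_iff zero_less_Suc if_True times_divide_eq_left)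
qed

lemma mean_decseq:
  fixes b :: "nat \<Rightarrow> real"
  assumes b: "decseq b"
  shows "decseq (\<lambda>n. (\<Sum>k<Suc n. b k) / real (Suc n))"
proof -
  have "incseq (\<lambda>n. - b n)" using b by (simp add: decseq_def incseq_def)
  from mean_incseq[OF this] show ?thesis
    by (simp add: sum_negf decseq_def incseq_def del: sum.lessThan_Suc)
qed

lemma sum_even_support:
  fixes c :: "nat \<Rightarrow> real"
  shows "(\<Sum>n<T. if even n then c n else 0) = (\<Sum>m<Suc T div 2. c (2 * m))"
proof (induction T)
  case (Suc T)
  then show ?case by (cases "even T") (auto elim!: evenE oddE)
qed simp

lemma half_ratio_tendsto: "(\<lambda>T. real (Suc T div 2) / real T) \<longlonglongrightarrow> 1 / 2"
proof (rule tendsto_sandwich)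
  show "\<forall>\<^sub>F T in sequentially. 1 / 2 \<le> real (Suc T div 2) / real T"
    using eventually_gt_at_top[of 0]
  proof eventually_elim
    case (elim T)
    have "T \<le> 2 * (Suc T div 2)" by presburger
    then have "real T \<le> 2 * real (Suc T div 2)" by linarith
    with elim show ?case by (simp add: field_simps)
  qed
  show "\<forall>\<^sub>F T in sequentially. real (Suc T div 2) / real T \<le> 1 / 2 + (1 / 2) * (1 / real T)"
    using eventually_gt_at_top[of 0]
  proof eventually_elim
    case (elim T)
    have "2 * (Suc T div 2) \<le> Suc T" by presburger
    then have "2 * real (Suc T div 2) \<le> 1 + real T" by linarith
    with elim show ?case by (simp add: field_simps)
  qed
  show "(\<lambda>T. 1 / 2 + (1 / 2) * (1 / real T)) \<longlonglongrightarrow> 1 / 2"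
    using tendsto_add[OF tendsto_const[of "1/2"] tendsto_mult[OF tendsto_const[of "1/2"] lim_1_over_n]]
    by simp
qed simp

text \<open>
  The partial sums themselves may oscillate: for an operator with eigenvalue \<open>-1\<close> the \<open>\<gamma> k\<close> do not tend to zero.
  Removing the last term from the partial sums that end at an even index leaves a nondecreasing sequence \<open>A\<close>, because
  it then only grows by pairs \<open>\<gamma> (2 m) + \<gamma> (2 m + 1) \<ge> 0\<close>.  The Cesaro means of \<open>A\<close> are nondecreasing and converge
  in the extended reals.  The removed terms \<open>D\<close> form a nonincreasing nonnegative sequence spread over the even
  indices, and their Cesaro means converge to half of the limit of that sequence's means.
\<close>

lemma mean_partial_sums_convergent:
  fixes \<gamma> :: "nat \<Rightarrow> real"
  assumes nonneg: "\<And>m. 0 \<le> \<gamma> (2 * m)"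
    and dec: "\<And>m. \<gamma> (2 * Suc m) \<le> \<gamma> (2 * m)"
    and pair: "\<And>m. 0 \<le> \<gamma> (2 * m) + \<gamma> (Suc (2 * m))"
  shows "convergent (\<lambda>T. ereal ((\<Sum>n<T. 2 * (\<Sum>k\<le>n. \<gamma> k) - \<gamma> 0) / real T))"
proof -
  define D where "D n = (if even n then \<gamma> n else 0)" for n
  define A where "A n = (\<Sum>k\<le>n. \<gamma> k) - D n" for n
  have "incseq A"
  proof (rule incseq_SucI)
    show "A n \<le> A (Suc n)" for n
      using pair[of "n div 2"] by (cases "even n") (auto simp: A_def D_def)
  qed
  from mean_incseq[OF this] have "incseq (\<lambda>n. ereal (2 * ((\<Sum>k<Suc n. A k) / real (Suc n))))"
    unfolding incseq_def ereal_less_eq(3) by (metis mult_left_mono zero_le_numeral)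
  from LIMSEQ_SUP[OF this] obtain L where
    "(\<lambda>n. ereal (2 * ((\<Sum>k<Suc n. A k) / real (Suc n)))) \<longlonglongrightarrow> L" by blast
  then have limA: "(\<lambda>T. ereal (2 * ((\<Sum>k<T. A k) / real T))) \<longlonglongrightarrow> L"
    by (subst filterlim_sequentially_Suc[symmetric])
  \<comment> \<open>The means of the removed terms over the even indices only; up to the factor of about one half
    between the number of even indices below \<open>T\<close> and \<open>T\<close>, these are the Cesaro means of \<open>D\<close>.\<close>
  define mean where "mean n = (\<Sum>m<Suc n. \<gamma> (2 * m)) / real (Suc n)" for n
  have "decseq (\<lambda>m. \<gamma> (2 * m))" by (rule decseq_SucI) (rule dec)
  from mean_decseq[OF this] have "decseq mean"
    by (simp add: mean_def[abs_def] del: sum.lessThan_Suc)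
  moreover have "0 \<le> mean n" for n
    unfolding mean_def by (intro divide_nonneg_nonneg sum_nonneg nonneg) simp
  ultimately obtain l where l: "mean \<longlonglongrightarrow> l"
    using decseq_convergent[of mean 0] by blast
  have sub: "filterlim (\<lambda>T. Suc T div 2 - 1) sequentially sequentially"
    unfolding filterlim_at_top
  proof
    show "\<forall>\<^sub>F T in sequentially. Z \<le> Suc T div 2 - 1" for Z
      using eventually_ge_at_top[of "2 * Z + 2"] by eventually_elim presburger
  qed
  have "(\<lambda>T. mean (Suc T div 2 - 1) * (real (Suc T div 2) / real T)) \<longlonglongrightarrow> l * (1 / 2)"
    by (intro tendsto_mult filterlim_compose[OF l sub] half_ratio_tendsto)
  moreover have "\<forall>\<^sub>F T in sequentially.
      mean (Suc T div 2 - 1) * (real (Suc T div 2) / real T) = (\<Sum>n<T. D n) / real T"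
    using eventually_gt_at_top[of 0]
  proof eventually_elim
    case (elim T)
    then have "Suc (Suc T div 2 - 1) = Suc T div 2" by presburger
    then have "mean (Suc T div 2 - 1) = (\<Sum>m<Suc T div 2. \<gamma> (2 * m)) / real (Suc T div 2)"
      by (simp only: mean_def)
    moreover have "0 < Suc T div 2" using elim by presburger
    ultimately show ?case by (simp add: D_def sum_even_support)
  qed
  ultimately have "(\<lambda>T. (\<Sum>n<T. D n) / real T) \<longlonglongrightarrow> l * (1 / 2)"
    by (rule Lim_transform_eventually)
  then have limD: "(\<lambda>T. ereal (2 * ((\<Sum>n<T. D n) / real T) - \<gamma> 0)) \<longlonglongrightarrow> ereal (2 * (l * (1 / 2)) - \<gamma> 0)"
    unfolding lim_ereal by (intro tendsto_intros)
  have "(\<lambda>T. ereal (2 * ((\<Sum>k<T. A k) / real T)) + ereal (2 * ((\<Sum>n<T. D n) / real T) - \<gamma> 0))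
      \<longlonglongrightarrow> L + ereal (2 * (l * (1 / 2)) - \<gamma> 0)"
    by (rule tendsto_add_ereal_general[OF _ limA limD]) auto
  moreover have "\<forall>\<^sub>F T in sequentially.
      ereal (2 * ((\<Sum>k<T. A k) / real T)) + ereal (2 * ((\<Sum>n<T. D n) / real T) - \<gamma> 0) =
      ereal ((\<Sum>n<T. 2 * (\<Sum>k\<le>n. \<gamma> k) - \<gamma> 0) / real T)"
    using eventually_gt_at_top[of 0]
  proof eventually_elim
    case (elim T)
    have "(\<Sum>n<T. 2 * (\<Sum>k\<le>n. \<gamma> k) - \<gamma> 0) = 2 * (\<Sum>k<T. A k) + 2 * (\<Sum>k<T. D k) - real T * \<gamma> 0"
      by (simp add: A_def sum_subtractf sum_distrib_left right_diff_distrib)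
    with elim show ?case by (simp add: field_simps)
  qed
  ultimately have "(\<lambda>T. ereal ((\<Sum>n<T. 2 * (\<Sum>k\<le>n. \<gamma> k) - \<gamma> 0) / real T))
      \<longlonglongrightarrow> L + ereal (2 * (l * (1 / 2)) - \<gamma> 0)"
    by (rule Lim_transform_eventually)
  then show ?thesis by (rule convergentI)
qed

context reversible_kernel
begin

lemma kernel_op_funpow_symmetric:
  assumes f: "f \<in> square_integrable \<pi>" and g: "g \<in> square_integrable \<pi>"
  shows "(\<integral>z. f z * (kernel_op K ^^ k) g z \<partial>\<pi>) = (\<integral>z. (kernel_op K ^^ k) f z * g z \<partial>\<pi>)"
  using f
proof (induction k arbitrary: f)
  case (Suc k)
  have "(\<integral>z. f z * (kernel_op K ^^ Suc k) g z \<partial>\<pi>) = (\<integral>z. kernel_op K f z * (kernel_op K ^^ k) g z \<partial>\<pi>)"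
    using kernel_op_symmetric[OF Suc.prems kernel_op_funpow_square_integrable[OF g, of k]]
    by (simp add: mult.commute)
  also have "\<dots> = (\<integral>z. (kernel_op K ^^ Suc k) f z * g z \<partial>\<pi>)"
    using Suc.IH[OF square_integrable_kernel_op[OF Suc.prems]] by (simp add: funpow_Suc_right del: funpow.simps)
  finally show ?case .
qed simp

lemma autocov_even:
  assumes g: "g \<in> square_integrable \<pi>"
  shows "autocov g (2 * m) = (\<integral>z. ((kernel_op K ^^ m) g z)\<^sup>2 \<partial>\<pi>)"
proof -
  have "(kernel_op K ^^ (2 * m)) g = (kernel_op K ^^ m) ((kernel_op K ^^ m) g)"
    by (simp add: mult_2 funpow_add)
  then show ?thesis
    using kernel_op_funpow_symmetric[OF g kernel_op_funpow_square_integrable[OF g, of m], of m]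
    by (simp add: autocov_def power2_eq_square)
qed

lemma autocov_odd:
  assumes g: "g \<in> square_integrable \<pi>"
  shows "autocov g (Suc (2 * m)) = (\<integral>z. (kernel_op K ^^ m) g z * kernel_op K ((kernel_op K ^^ m) g) z \<partial>\<pi>)"
proof -
  have "(kernel_op K ^^ (Suc (2 * m))) g = (kernel_op K ^^ m) ((kernel_op K ^^ Suc m) g)"
    by (simp add: mult_2 funpow_add[symmetric, THEN fun_cong, unfolded comp_def] del: funpow.simps)
  then show ?thesis
    using kernel_op_funpow_symmetric[OF g kernel_op_funpow_square_integrable[OF g, of "Suc m"], of m]
    by (simp add: autocov_def)
qed

text \<open>
  Positivity of \<open>1 + K\<close>: expand \<open>\<parallel>u + K u\<parallel>\<^sup>2 \<ge> 0\<close> and use that \<open>K\<close> is a contraction.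
\<close>

lemma kernel_op_quadratic_form_ge:
  assumes u: "u \<in> square_integrable \<pi>"
  shows "0 \<le> (\<integral>z. (u z)\<^sup>2 \<partial>\<pi>) + (\<integral>z. u z * kernel_op K u z \<partial>\<pi>)"
proof -
  note Pu = square_integrable_kernel_op[OF u]
  have "0 \<le> (\<integral>z. (u z + kernel_op K u z)\<^sup>2 \<partial>\<pi>)" by simp
  also have "\<dots> = (\<integral>z. (u z)\<^sup>2 + (kernel_op K u z)\<^sup>2 + 2 * (u z * kernel_op K u z) \<partial>\<pi>)"
    by (simp add: power2_sum mult.assoc)
  also have "\<dots> = (\<integral>z. (u z)\<^sup>2 \<partial>\<pi>) + (\<integral>z. (kernel_op K u z)\<^sup>2 \<partial>\<pi>) + 2 * (\<integral>z. u z * kernel_op K u z \<partial>\<pi>)"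
    using square_integrableD(2)[OF u] square_integrableD(2)[OF Pu] integrable_mult_square_integrable[OF u Pu]
    by simp
  finally show ?thesis using integral_square_kernel_op_le[OF u] by linarith
qed

text \<open>
  The asymptotic variance is defined as a limit, which carries no information unless the sequence converges.  For
  reversible kernels it always does, possibly to infinity.
\<close>

theorem scaled_variance_tendsto_asymp_var:
  assumes f: "f \<in> square_integrable \<pi>"
  shows "(\<lambda>T. ereal (real T * variance_of (chain_law \<pi> K) (\<lambda>\<omega>. (1 / real T) * (\<Sum>t = 1..T. f (\<omega> t)))))
    \<longlonglongrightarrow> asymp_var \<pi> K f"
proof -
  define g where "g = (\<lambda>z. f z - (\<integral>w. f w \<partial>\<pi>))"
  have g: "g \<in> square_integrable \<pi>"
    unfolding g_def by (intro square_integrable_diff f square_integrable_const)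
  note Pg = kernel_op_funpow_square_integrable[OF g]
  have "convergent (\<lambda>T. ereal ((\<Sum>n<T. 2 * (\<Sum>k\<le>n. autocov g k) - autocov g 0) / real T))"
  proof (rule mean_partial_sums_convergent)
    fix m
    show "0 \<le> autocov g (2 * m)" by (simp add: autocov_even[OF g])
    show "autocov g (2 * Suc m) \<le> autocov g (2 * m)"
      unfolding autocov_even[OF g] using integral_square_kernel_op_le[OF Pg[of m]] by simp
    show "0 \<le> autocov g (2 * m) + autocov g (Suc (2 * m))"
      unfolding autocov_even[OF g] autocov_odd[OF g] by (rule kernel_op_quadratic_form_ge[OF Pg])
  qed
  then obtain L where "(\<lambda>T. ereal ((\<Sum>n<T. 2 * (\<Sum>k\<le>n. autocov g k) - autocov g 0) / real T)) \<longlonglongrightarrow> L"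
    by (auto simp: convergent_def)
  moreover have "\<forall>\<^sub>F T in sequentially. ereal ((\<Sum>n<T. 2 * (\<Sum>k\<le>n. autocov g k) - autocov g 0) / real T) =
      ereal (real T * variance_of (chain_law \<pi> K) (\<lambda>\<omega>. (1 / real T) * (\<Sum>t = 1..T. f (\<omega> t))))"
    using eventually_ge_at_top[of 1]
    by eventually_elim (simp only: scaled_variance_eq_autocov_sum[OF f] g_def lag_sum_eq)
  ultimately have "(\<lambda>T. ereal (real T * variance_of (chain_law \<pi> K) (\<lambda>\<omega>. (1 / real T) * (\<Sum>t = 1..T. f (\<omega> t)))))
      \<longlonglongrightarrow> L"
    by (rule Lim_transform_eventually)
  then show ?thesis unfolding asymp_var_def by (simp add: limI)
qed

end

section \<open>Boundedness of the spectrum from above\<close>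

text \<open>
  Jensen's inequality for an infinite sum with total weight at most one.  With \<open>m\<close> the weighted sum of the \<open>a k\<close>, it is
  the expansion of \<open>\<Sum>k. c k * (a k - m)\<^sup>2 \<ge> 0\<close>.
\<close>

lemma square_suminf_le:
  fixes c a :: "nat \<Rightarrow> real"
  assumes c: "\<And>k. 0 \<le> c k" "summable c" "suminf c \<le> 1"
    and sq: "summable (\<lambda>k. c k * (a k)\<^sup>2)"
  shows "summable (\<lambda>k. c k * \<bar>a k\<bar>)" and "(\<Sum>k. c k * a k)\<^sup>2 \<le> (\<Sum>k. c k * (a k)\<^sup>2)"
proof -
  show abs: "summable (\<lambda>k. c k * \<bar>a k\<bar>)"
  proof (rule summable_comparison_test')
    show "summable (\<lambda>k. c k + c k * (a k)\<^sup>2)" by (intro summable_add c sq)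
    show "norm (c k * \<bar>a k\<bar>) \<le> c k + c k * (a k)\<^sup>2" for k
    proof -
      have "\<bar>a k\<bar> \<le> 1 + (a k)\<^sup>2"
        using zero_le_power2[of "\<bar>a k\<bar> - 1"] abs_ge_zero[of "a k"] unfolding power2_diff power2_abs
        by (smt (verit) one_power2 mult_cancel_left1)
      from mult_left_mono[OF this c(1)[of k]] show ?thesis
        using c(1)[of k] by (simp add: abs_mult distrib_left)
    qed
  qed
  have lin: "summable (\<lambda>k. c k * a k)"
    by (rule summable_rabs_cancel) (use abs c(1) in \<open>simp add: abs_mult\<close>)
  define m where "m = (\<Sum>k. c k * a k)"
  have "0 \<le> (\<Sum>k. c k * (a k)\<^sup>2 - 2 * m * (c k * a k) + m\<^sup>2 * c k)"
  proof (rule suminf_nonneg)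
    show "summable (\<lambda>k. c k * (a k)\<^sup>2 - 2 * m * (c k * a k) + m\<^sup>2 * c k)"
      by (intro summable_add summable_diff summable_mult sq lin c)
    show "0 \<le> c k * (a k)\<^sup>2 - 2 * m * (c k * a k) + m\<^sup>2 * c k" for k
    proof -
      have "c k * (a k)\<^sup>2 - 2 * m * (c k * a k) + m\<^sup>2 * c k = c k * (a k - m)\<^sup>2"
        by (simp add: power2_diff algebra_simps)
      then show ?thesis using c(1)[of k] by simp
    qed
  qed
  also have "\<dots> = (\<Sum>k. c k * (a k)\<^sup>2) - 2 * m * m + m\<^sup>2 * suminf c"
    by (simp add: m_def[symmetric] suminf_add[symmetric] suminf_diff[symmetric] suminf_mult
      summable_diff summable_mult sq lin c)
  also have "\<dots> \<le> (\<Sum>k. c k * (a k)\<^sup>2) - m\<^sup>2"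
    using mult_left_mono[OF c(3), of "m\<^sup>2"] by (simp add: power2_eq_square)
  finally show "(\<Sum>k. c k * a k)\<^sup>2 \<le> (\<Sum>k. c k * (a k)\<^sup>2)" by (simp add: m_def)
qed

lemma
  fixes f :: "nat \<Rightarrow> 'a \<Rightarrow> real"
  assumes meas[measurable]: "\<And>k. f k \<in> borel_measurable M"
    and fin: "(\<integral>\<^sup>+x. (\<Sum>k. ennreal \<bar>f k x\<bar>) \<partial>M) < \<infinity>"
  shows AE_summable_nn: "AE x in M. summable (\<lambda>k. \<bar>f k x\<bar>)"
    and integrable_suminf_nn: "integrable M (\<lambda>x. \<Sum>k. f k x)"
    and integral_suminf_nn: "(\<integral>x. (\<Sum>k. f k x) \<partial>M) = (\<Sum>k. \<integral>x. f k x \<partial>M)"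
proof -
  have "AE x in M. (\<Sum>k. ennreal \<bar>f k x\<bar>) \<noteq> \<infinity>"
    using fin by (intro nn_integral_PInf_AE) (auto simp: less_top)
  then show AE: "AE x in M. summable (\<lambda>k. \<bar>f k x\<bar>)"
    by eventually_elim (rule summable_suminf_not_top, auto)
  have eq: "(\<Sum>k. \<integral>\<^sup>+x. ennreal \<bar>f k x\<bar> \<partial>M) = (\<integral>\<^sup>+x. (\<Sum>k. ennreal \<bar>f k x\<bar>) \<partial>M)"
    by (rule nn_integral_suminf[symmetric]) measurable
  have "(\<integral>\<^sup>+x. ennreal \<bar>f k x\<bar> \<partial>M) < \<infinity>" for k
  proof -
    have "(\<integral>\<^sup>+x. ennreal \<bar>f k x\<bar> \<partial>M) \<le> (\<Sum>k. \<integral>\<^sup>+x. ennreal \<bar>f k x\<bar> \<partial>M)"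
      using sum_le_suminf[of "\<lambda>k. \<integral>\<^sup>+x. ennreal \<bar>f k x\<bar> \<partial>M" "{k}"] by simp
    then show ?thesis using fin eq by (metis le_less_trans)
  qed
  then have int: "integrable M (f k)" for k
    by (intro integrableI_bounded) auto
  have nn: "(\<integral>\<^sup>+x. ennreal \<bar>f k x\<bar> \<partial>M) = ennreal (\<integral>x. \<bar>f k x\<bar> \<partial>M)" for k
    using int[of k] by (intro nn_integral_eq_integral) auto
  have "summable (\<lambda>k. \<integral>x. \<bar>f k x\<bar> \<partial>M)"
  proof (rule summable_suminf_not_top)
    show "(\<Sum>k. ennreal (\<integral>x. \<bar>f k x\<bar> \<partial>M)) \<noteq> top"
      using fin eq by (simp add: nn less_top)
  qed simp
  then have sum: "summable (\<lambda>k. \<integral>x. norm (f k x) \<partial>M)" by simp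
  have AE': "AE x in M. summable (\<lambda>k. norm (f k x))" using AE by simp
  show "integrable M (\<lambda>x. \<Sum>k. f k x)" by (rule integrable_suminf[OF int AE' sum])
  show "(\<integral>x. (\<Sum>k. f k x) \<partial>M) = (\<Sum>k. \<integral>x. f k x \<partial>M)"
    by (rule integral_suminf[OF int AE' sum])
qed

text \<open>
  Injectivity is a consequence of the lower bound, so only surjectivity and the lower bound have to be checked.
\<close>

lemma regular_value0_iff:
  "regular_value0 \<pi> k s \<longleftrightarrow>
     (\<forall>g \<in> mean_zero \<pi>. \<exists>h \<in> mean_zero \<pi>. AE z in \<pi>. s * h z - kernel_op k h z = g z) \<and>
     (\<exists>C. \<forall>h \<in> mean_zero \<pi>. L2_norm \<pi> h \<le> C * L2_norm \<pi> (\<lambda>z. s * h z - kernel_op k h z))"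
  (is "_ \<longleftrightarrow> ?onto \<and> ?bounded")
proof
  assume *: "?onto \<and> ?bounded"
  then obtain C where C: "\<And>h. h \<in> mean_zero \<pi> \<Longrightarrow> L2_norm \<pi> h \<le> C * L2_norm \<pi> (\<lambda>z. s * h z - kernel_op k h z)"
    by blast
  have "AE z in \<pi>. h z = 0"
    if h: "h \<in> mean_zero \<pi>" and 0: "AE z in \<pi>. s * h z - kernel_op k h z = 0" for h
  proof -
    have "AE z in \<pi>. (s * h z - kernel_op k h z)\<^sup>2 = 0" using 0 by eventually_elim simp
    then have "L2_norm \<pi> (\<lambda>z. s * h z - kernel_op k h z) = 0"
      by (simp add: L2_norm_def integral_eq_zero_AE)
    with C[OF h] have "(\<integral>z. (h z)\<^sup>2 \<partial>\<pi>) \<le> 0" by (simp add: L2_norm_def)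
    then have "(\<integral>z. (h z)\<^sup>2 \<partial>\<pi>) = 0" by (simp add: antisym)
    then have "AE z in \<pi>. (h z)\<^sup>2 = 0"
      using h by (subst (asm) integral_nonneg_eq_0_iff_AE) (auto simp: mean_zero_def square_integrable_def)
    then show ?thesis by eventually_elim simp
  qed
  with * show "regular_value0 \<pi> k s" by (simp add: regular_value0_def)
qed (simp add: regular_value0_def)

context invariant_kernel
begin

lemma integral_square_funpow_le:
  assumes g: "g \<in> square_integrable \<pi>"
  shows "(\<integral>z. ((kernel_op K ^^ n) g z)\<^sup>2 \<partial>\<pi>) \<le> (\<integral>z. (g z)\<^sup>2 \<partial>\<pi>)"
proof (induction n)
  case (Suc n)
  then show ?case
    using integral_square_kernel_op_le[OF kernel_op_funpow_square_integrable[OF g, of n]] by simp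
qed simp

text \<open>
  The solution is the Neumann series \<open>h = \<Sum>k. s\<^sup>-\<^sup>(\<^sup>k\<^sup>+\<^sup>1\<^sup>) K\<^sup>k g\<close>.  Summing it pointwise
  avoids any appeal to completeness of \<open>L\<^sup>2(\<pi>)\<close>: since \<open>K\<close> is a contraction, the weighted sum of the squares
  \<open>(K\<^sup>k g)\<^sup>2\<close> has finite integral, hence is finite almost everywhere, and Jensen's inequality for sums bounds
  \<open>h\<^sup>2\<close> by it.  For \<open>s \<ge> 2\<close> the weights \<open>s\<^sup>-\<^sup>(\<^sup>k\<^sup>+\<^sup>1\<^sup>)\<close> add up to \<open>1 / (s - 1) \<le> 1\<close>, as that inequality
  requires.
\<close>

lemma resolvent_onto:
  assumes s: "2 \<le> s" and g: "g \<in> mean_zero \<pi>"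
  shows "\<exists>h \<in> mean_zero \<pi>. AE z in \<pi>. s * h z - kernel_op K h z = g z"
proof -
  have g2: "g \<in> square_integrable \<pi>" using g by (simp add: mean_zero_def)
  define v where "v n = (kernel_op K ^^ n) g" for n
  have v2: "v n \<in> square_integrable \<pi>" for n
    unfolding v_def by (rule kernel_op_funpow_square_integrable[OF g2])
  have vm[measurable]: "v n \<in> borel_measurable \<pi>" for n by (rule square_integrableD[OF v2])
  define c where "c k = (1 / s) ^ Suc k" for k
  have c0: "0 \<le> c k" for k using s by (simp add: c_def)
  have "(\<lambda>k. (1 / s) ^ k) sums (1 / (1 - 1 / s))" using s by (intro geometric_sums) simp
  from sums_mult[OF this, of "1 / s"] have csums: "c sums (1 / s * (1 / (1 - 1 / s)))"
    by (simp add: c_def[abs_def])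
  have "1 / s * (1 / (1 - 1 / s)) = 1 / (s - 1)" using s by (simp add: field_simps)
  then have c1: "summable c" "suminf c \<le> 1"
    using csums s by (simp_all add: sums_iff)
  define G where "G = (\<integral>z. (g z)\<^sup>2 \<partial>\<pi>)"
  have vG: "(\<integral>z. (v k z)\<^sup>2 \<partial>\<pi>) \<le> G" for k
    unfolding v_def G_def by (rule integral_square_funpow_le[OF g2])
  have bound: "(\<integral>\<^sup>+z. (\<Sum>k. ennreal \<bar>c k * (v k z)\<^sup>2\<bar>) \<partial>\<pi>) < \<infinity>"
  proof -
    have "(\<integral>\<^sup>+z. (\<Sum>k. ennreal \<bar>c k * (v k z)\<^sup>2\<bar>) \<partial>\<pi>) = (\<Sum>k. \<integral>\<^sup>+z. ennreal \<bar>c k * (v k z)\<^sup>2\<bar> \<partial>\<pi>)"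
      by (rule nn_integral_suminf) measurable
    also have "\<dots> = (\<Sum>k. ennreal (c k * (\<integral>z. (v k z)\<^sup>2 \<partial>\<pi>)))"
    proof (rule suminf_cong)
      fix k
      have "(\<integral>\<^sup>+z. ennreal \<bar>c k * (v k z)\<^sup>2\<bar> \<partial>\<pi>) = ennreal (\<integral>z. \<bar>c k * (v k z)\<^sup>2\<bar> \<partial>\<pi>)"
        using square_integrableD(2)[OF v2[of k]] by (intro nn_integral_eq_integral) auto
      then show "(\<integral>\<^sup>+z. ennreal \<bar>c k * (v k z)\<^sup>2\<bar> \<partial>\<pi>) = ennreal (c k * (\<integral>z. (v k z)\<^sup>2 \<partial>\<pi>))"
        using c0[of k] by (simp add: abs_mult)
    qed
    also have "\<dots> \<le> (\<Sum>k. ennreal (c k * G))"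
      by (intro suminf_le ennreal_leI mult_left_mono vG c0) auto
    also have "\<dots> = ennreal (\<Sum>k. c k * G)"
      using c0 c1 vG[of 0] by (intro suminf_ennreal2 summable_mult2)
        (auto intro!: mult_nonneg_nonneg simp: G_def)
    finally show ?thesis by (simp add: le_less_trans)
  qed
  have qsum: "AE z in \<pi>. summable (\<lambda>k. c k * (v k z)\<^sup>2)"
    using AE_summable_nn[OF _ bound] c0 by (simp add: abs_mult)
  have qint: "integrable \<pi> (\<lambda>z. \<Sum>k. c k * (v k z)\<^sup>2)"
    by (rule integrable_suminf_nn[OF _ bound]) measurable
  define h where "h z = (\<Sum>k. c k * v k z)" for z
  have hm[measurable]: "h \<in> borel_measurable \<pi>"
    unfolding h_def[abs_def] by measurable
  have "AE z in \<pi>. norm ((h z)\<^sup>2) \<le> norm (\<Sum>k. c k * (v k z)\<^sup>2)"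
    using qsum
  proof eventually_elim
    case (elim z)
    have "(h z)\<^sup>2 \<le> (\<Sum>k. c k * (v k z)\<^sup>2)"
      unfolding h_def by (rule square_suminf_le(2)[OF c0 c1 elim])
    then show ?case by simp
  qed
  from Bochner_Integration.integrable_bound[OF qint _ this] have h2: "h \<in> square_integrable \<pi>"
    by (simp add: square_integrable_def)
  \<comment> \<open>Absolute summability in \<open>L\<^sup>1(\<pi>)\<close>, from \<open>\<bar>v\<bar> \<le> 1 + v\<^sup>2\<close>.  By invariance it also holds in \<open>L\<^sup>1\<close> of almost
    every transition measure, so that the operator may be applied to the series term by term.\<close>
  have l1: "(\<integral>\<^sup>+z. (\<Sum>k. ennreal \<bar>c k * v k z\<bar>) \<partial>\<pi>) < \<infinity>"
  proof -
    have "(\<integral>\<^sup>+z. (\<Sum>k. ennreal \<bar>c k * v k z\<bar>) \<partial>\<pi>) \<le>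
        (\<integral>\<^sup>+z. ennreal (suminf c) + (\<Sum>k. ennreal \<bar>c k * (v k z)\<^sup>2\<bar>) \<partial>\<pi>)"
    proof (rule nn_integral_mono)
      fix z
      have "(\<Sum>k. ennreal \<bar>c k * v k z\<bar>) \<le> (\<Sum>k. ennreal (c k) + ennreal \<bar>c k * (v k z)\<^sup>2\<bar>)"
      proof (rule suminf_le)
        fix k
        have "\<bar>v k z\<bar> \<le> 1 + (v k z)\<^sup>2"
          using zero_le_power2[of "\<bar>v k z\<bar> - 1"] abs_ge_zero[of "v k z"]
          unfolding power2_diff power2_abs by (smt (verit) one_power2 mult_cancel_left1)
        from mult_left_mono[OF this c0[of k]]
        have "\<bar>c k * v k z\<bar> \<le> c k + \<bar>c k * (v k z)\<^sup>2\<bar>"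
          using c0[of k] by (simp add: abs_mult distrib_left)
        then show "ennreal \<bar>c k * v k z\<bar> \<le> ennreal (c k) + ennreal \<bar>c k * (v k z)\<^sup>2\<bar>"
          using c0[of k] by (simp add: ennreal_plus[symmetric] ennreal_leI del: ennreal_plus)
      qed auto
      also have "\<dots> = (\<Sum>k. ennreal (c k)) + (\<Sum>k. ennreal \<bar>c k * (v k z)\<^sup>2\<bar>)"
        by (rule suminf_add[symmetric]) auto
      finally show "(\<Sum>k. ennreal \<bar>c k * v k z\<bar>) \<le> ennreal (suminf c) + (\<Sum>k. ennreal \<bar>c k * (v k z)\<^sup>2\<bar>)"
        using c0 c1 by (simp add: suminf_ennreal2)
    qed
    also have "\<dots> = ennreal (suminf c) + (\<integral>\<^sup>+z. (\<Sum>k. ennreal \<bar>c k * (v k z)\<^sup>2\<bar>) \<partial>\<pi>)"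
      by (subst nn_integral_add) (auto simp: emeasure_space_1)
    also have "\<dots> < \<infinity>" using bound by simp
    finally show ?thesis .
  qed
  have lsum: "AE z in \<pi>. summable (\<lambda>k. \<bar>c k * v k z\<bar>)"
    by (rule AE_summable_nn[OF _ l1]) measurable
  have "(\<integral>\<^sup>+z. (\<integral>\<^sup>+w. (\<Sum>k. ennreal \<bar>c k * v k w\<bar>) \<partial>K z) \<partial>\<pi>) < \<infinity>"
    using l1 by (subst nn_integral_invariant) auto
  then have "AE z in \<pi>. (\<integral>\<^sup>+w. (\<Sum>k. ennreal \<bar>c k * v k w\<bar>) \<partial>K z) \<noteq> \<infinity>"
    by (intro nn_integral_PInf_AE) (auto simp: less_top)
  then have Kh: "AE z in \<pi>. kernel_op K h z = (\<Sum>k. c k * v (Suc k) z)"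
    using AE_space
  proof eventually_elim
    case (elim z)
    have "(\<lambda>w. c k * v k w) \<in> borel_measurable (K z)" for k
      unfolding measurable_cong_sets[OF sets_K[OF elim(2)] refl] by measurable
    from integral_suminf_nn[OF this] elim(1) show ?case
      by (simp add: kernel_op_def h_def less_top v_def)
  qed
  have eq: "AE z in \<pi>. s * h z - kernel_op K h z = g z"
    using Kh lsum
  proof eventually_elim
    case (elim z)
    have sc: "s * c (Suc k) = c k" "s * c 0 = 1" for k using s by (simp_all add: c_def)
    have sm: "summable (\<lambda>k. c k * v k z)" using elim(2) by (rule summable_rabs_cancel)
    have "s * h z = (\<Sum>k. s * (c k * v k z))"
      unfolding h_def by (rule suminf_mult[OF sm, symmetric])
    also have "\<dots> = (\<Sum>k. s * (c (Suc k) * v (Suc k) z)) + s * (c 0 * v 0 z)"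
      using suminf_split_head[OF summable_mult[OF sm, of s]] by simp
    also have "\<dots> = kernel_op K h z + g z"
      unfolding mult.assoc[symmetric] sc by (simp add: elim(1) v_def)
    finally show ?case by simp
  qed
  have ih: "integrable \<pi> h" and ig: "integrable \<pi> g"
    using h2 g2 by (auto intro: integrable_square_integrable)
  \<comment> \<open>The operator preserves the mean, so integrating the equation gives \<open>(s - 1) \<integral> h = \<integral> g = 0\<close>.\<close>
  have "(\<integral>z. s * h z - kernel_op K h z \<partial>\<pi>) = (\<integral>z. g z \<partial>\<pi>)"
    using eq by (intro integral_cong_AE) (use square_integrableD(1)[OF g2] in auto)
  then have "s * (\<integral>z. h z \<partial>\<pi>) = (\<integral>z. h z \<partial>\<pi>)"
    using g ih integrable_kernel_op[OF ih] by (simp add: integral_kernel_op[OF ih] mean_zero_def)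
  then have "(\<integral>z. h z \<partial>\<pi>) = 0" using s by simp
  with h2 eq show ?thesis by (intro bexI[of _ h]) (auto simp: mean_zero_def)
qed

text \<open>
  If \<open>u = s h - K h\<close>, then \<open>s\<^sup>2 \<parallel>h\<parallel>\<^sup>2 = \<parallel>u + K h\<parallel>\<^sup>2 \<le> 2 \<parallel>u\<parallel>\<^sup>2 + 2 \<parallel>h\<parallel>\<^sup>2\<close>, and \<open>s\<^sup>2 \<ge> 4\<close> leaves
  \<open>\<parallel>h\<parallel> \<le> \<parallel>u\<parallel>\<close>.  The threshold two is not sharp; any upper bound for the spectrum serves the comparison of suprema.
\<close>

lemma regular_value0_ge_2:
  assumes s: "2 \<le> s"
  shows "regular_value0 \<pi> K s"
proof -
  have "L2_norm \<pi> h \<le> 1 * L2_norm \<pi> (\<lambda>z. s * h z - kernel_op K h z)" if "h \<in> mean_zero \<pi>" for h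
  proof (subst L2_norm_le_iff)
    have h: "h \<in> square_integrable \<pi>" using that by (simp add: mean_zero_def)
    note Kh = square_integrable_kernel_op[OF h]
    have u: "(\<lambda>z. s * h z - kernel_op K h z) \<in> square_integrable \<pi>"
      by (intro square_integrable_diff square_integrable_cmult h Kh)
    have "s\<^sup>2 * (\<integral>z. (h z)\<^sup>2 \<partial>\<pi>) = (\<integral>z. ((s * h z - kernel_op K h z) + kernel_op K h z)\<^sup>2 \<partial>\<pi>)"
      by (simp add: power_mult_distrib)
    also have "\<dots> \<le> 2 * (\<integral>z. (s * h z - kernel_op K h z)\<^sup>2 \<partial>\<pi>) + 2 * (\<integral>z. (kernel_op K h z)\<^sup>2 \<partial>\<pi>)"
      by (rule integral_square_add_le[OF u Kh])
    finally have "s\<^sup>2 * (\<integral>z. (h z)\<^sup>2 \<partial>\<pi>) \<le>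
        2 * (\<integral>z. (s * h z - kernel_op K h z)\<^sup>2 \<partial>\<pi>) + 2 * (\<integral>z. (h z)\<^sup>2 \<partial>\<pi>)"
      using integral_square_kernel_op_le[OF h] by linarith
    moreover have "4 * (\<integral>z. (h z)\<^sup>2 \<partial>\<pi>) \<le> s\<^sup>2 * (\<integral>z. (h z)\<^sup>2 \<partial>\<pi>)"
      using power_mono[OF s, of 2] by (intro mult_right_mono) auto
    ultimately show "(\<integral>z. (h z)\<^sup>2 \<partial>\<pi>) \<le> 1\<^sup>2 * (\<integral>z. (s * h z - kernel_op K h z)\<^sup>2 \<partial>\<pi>)" by simp
  qed simp
  then show ?thesis
    using resolvent_onto[OF s] unfolding regular_value0_iff by blast
qed

lemma bdd_above_spectrum0: "bdd_above (spectrum0 \<pi> K)"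
proof (rule bdd_aboveI)
  show "s \<le> 2" if "s \<in> spectrum0 \<pi> K" for s
    using that regular_value0_ge_2[of s] by (cases "2 \<le> s") (auto simp: spectrum0_def)
qed

end

section \<open>Comparison of a reversible kernel with its refreshed version\<close>

text \<open>
  \<open>E\<close> is a conditional expectation (a reversible idempotent kernel), \<open>B\<close> a reversible kernel commuting with it, and
  \<open>M\<close> is \<open>B\<close> combined with a refreshment by \<open>E\<close> before or after.  The function \<open>r\<close> is the probability that \<open>B\<close> holds
  its state; it is measurable with respect to the information that \<open>E\<close> conditions on.  The last assumption
  says that the measures \<open>B z\<close> and \<open>M z\<close> differ only in the held mass, which \<open>B\<close> leaves at \<open>z\<close> and \<open>M\<close> redistributes
  by \<open>E z\<close>; it is written additively because nonnegative extended integrals cannot be subtracted.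
\<close>

locale refreshment = E: reversible_kernel \<pi> E + B: reversible_kernel \<pi> B
  for \<pi> :: "'z measure" and E B :: "'z \<Rightarrow> 'z measure" +
  fixes M :: "'z \<Rightarrow> 'z measure" and r :: "'z \<Rightarrow> real"
  assumes E_then_B: "\<And>z. z \<in> space \<pi> \<Longrightarrow> E z \<bind> B = M z"
    and B_then_E: "\<And>z. z \<in> space \<pi> \<Longrightarrow> B z \<bind> E = M z"
    and E_then_E: "\<And>z. z \<in> space \<pi> \<Longrightarrow> E z \<bind> E = E z"
    and hold_measurable[measurable]: "r \<in> borel_measurable \<pi>"
    and hold_nonneg: "\<And>z. 0 \<le> r z" and hold_le_1: "\<And>z. r z \<le> 1"
    and hold_invariant: "\<And>z. z \<in> space \<pi> \<Longrightarrow> AE w in E z. r w = r z"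
    and hold_exchange: "\<And>z (f :: 'z \<Rightarrow> ennreal). z \<in> space \<pi> \<Longrightarrow> f \<in> borel_measurable \<pi> \<Longrightarrow>
      (\<integral>\<^sup>+w. f w \<partial>B z) + ennreal (r z) * (\<integral>\<^sup>+w. f w \<partial>E z) = (\<integral>\<^sup>+w. f w \<partial>M z) + ennreal (r z) * f z"
begin

lemma nn_integral_M_BE:
  assumes z: "z \<in> space \<pi>" and f[measurable]: "f \<in> borel_measurable \<pi>"
  shows "(\<integral>\<^sup>+w. f w \<partial>M z) = (\<integral>\<^sup>+w. (\<integral>\<^sup>+x. f x \<partial>E w) \<partial>B z)"
  unfolding B_then_E[OF z, symmetric]
  by (rule nn_integral_bind[OF f]) (simp add: measurable_cong_sets[OF B.sets_K[OF z] refl] E.kernel_sub)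

lemma nn_integral_M_EB:
  assumes z: "z \<in> space \<pi>" and f[measurable]: "f \<in> borel_measurable \<pi>"
  shows "(\<integral>\<^sup>+w. f w \<partial>M z) = (\<integral>\<^sup>+w. (\<integral>\<^sup>+x. f x \<partial>B w) \<partial>E z)"
  unfolding E_then_B[OF z, symmetric]
  by (rule nn_integral_bind[OF f]) (simp add: measurable_cong_sets[OF E.sets_K[OF z] refl] B.kernel_sub)

text \<open>
  \<open>M = B E = E B\<close> is a product of two commuting self-adjoint operators.
\<close>

sublocale M: reversible_kernel \<pi> M
proof
  have "(\<lambda>z. E z \<bind> B) \<in> \<pi> \<rightarrow>\<^sub>M prob_algebra \<pi>"
    by (rule measurable_bind_prob_space[OF E.kernel B.kernel])
  then show "M \<in> \<pi> \<rightarrow>\<^sub>M prob_algebra \<pi>"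
    by (subst measurable_cong[OF E_then_B[symmetric]])
next
  fix u v :: "'z \<Rightarrow> ennreal"
  assume u[measurable]: "u \<in> borel_measurable \<pi>" and v[measurable]: "v \<in> borel_measurable \<pi>"
  have "(\<integral>\<^sup>+z. u z * (\<integral>\<^sup>+w. v w \<partial>M z) \<partial>\<pi>) = (\<integral>\<^sup>+z. u z * (\<integral>\<^sup>+w. (\<integral>\<^sup>+x. v x \<partial>E w) \<partial>B z) \<partial>\<pi>)"
    by (intro nn_integral_cong) (simp add: nn_integral_M_BE)
  also have "\<dots> = (\<integral>\<^sup>+z. (\<integral>\<^sup>+x. v x \<partial>E z) * (\<integral>\<^sup>+w. u w \<partial>B z) \<partial>\<pi>)"
    by (rule B.reversible) measurable
  also have "\<dots> = (\<integral>\<^sup>+z. (\<integral>\<^sup>+w. u w \<partial>B z) * (\<integral>\<^sup>+x. v x \<partial>E z) \<partial>\<pi>)"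
    by (simp add: mult.commute)
  also have "\<dots> = (\<integral>\<^sup>+z. v z * (\<integral>\<^sup>+w. (\<integral>\<^sup>+x. u x \<partial>B w) \<partial>E z) \<partial>\<pi>)"
    by (rule E.reversible) measurable
  also have "\<dots> = (\<integral>\<^sup>+z. v z * (\<integral>\<^sup>+w. u w \<partial>M z) \<partial>\<pi>)"
    by (intro nn_integral_cong) (simp add: nn_integral_M_EB)
  finally show "(\<integral>\<^sup>+z. u z * (\<integral>\<^sup>+w. v w \<partial>M z) \<partial>\<pi>) = (\<integral>\<^sup>+z. v z * (\<integral>\<^sup>+w. u w \<partial>M z) \<partial>\<pi>)" .
qed

abbreviation "PE \<equiv> kernel_op E"
abbreviation "PB \<equiv> kernel_op B"
abbreviation "PM \<equiv> kernel_op M"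

lemma PM_eq_PB_PE: "integrable \<pi> f \<Longrightarrow> AE z in \<pi>. PM f z = PB (PE f) z"
  by (rule composed_kernel_op[OF B.invariant_kernel_axioms E.invariant_kernel_axioms
    M.invariant_kernel_axioms B_then_E])

lemma PM_eq_PE_PB: "integrable \<pi> f \<Longrightarrow> AE z in \<pi>. PM f z = PE (PB f) z"
  by (rule composed_kernel_op[OF E.invariant_kernel_axioms B.invariant_kernel_axioms
    M.invariant_kernel_axioms E_then_B])

lemma PE_idem: "integrable \<pi> f \<Longrightarrow> AE z in \<pi>. PE f z = PE (PE f) z"
  by (rule composed_kernel_op[OF E.invariant_kernel_axioms E.invariant_kernel_axioms
    E.invariant_kernel_axioms E_then_E])

text \<open>
  The operator form \<open>B = M + r (1 - E)\<close>.  The additive identity of the locale is applied to the positive and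
  negative parts of \<open>f\<close>, at the points where all three transition measures integrate \<open>f\<close>.
\<close>

lemma PB_eq_PM_plus_hold:
  assumes f: "integrable \<pi> f"
  shows "AE z in \<pi>. PB f z = PM f z + r z * (f z - PE f z)"
proof -
  have fm[measurable]: "f \<in> borel_measurable \<pi>" using f by auto
  show ?thesis
    using B.AE_integrable_kernel[OF f] E.AE_integrable_kernel[OF f] M.AE_integrable_kernel[OF f] AE_space
  proof eventually_elim
    case (elim z)
    have nonneg: "(\<integral>w. h w \<partial>B z) + r z * (\<integral>w. h w \<partial>E z) = (\<integral>w. h w \<partial>M z) + r z * h z"
      if h: "h \<in> borel_measurable \<pi>" "\<And>w. 0 \<le> h w"
        "integrable (B z) h" "integrable (E z) h" "integrable (M z) h" for h
    proof -
      have "ennreal ((\<integral>w. h w \<partial>B z) + r z * (\<integral>w. h w \<partial>E z)) = ennreal ((\<integral>w. h w \<partial>M z) + r z * h z)"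
        using hold_exchange[OF elim(4), of "\<lambda>w. ennreal (h w)"] h hold_nonneg[of z]
        by (simp add: nn_integral_eq_integral ennreal_mult' ennreal_plus)
      then show ?thesis
        using h hold_nonneg[of z] by (subst (asm) ennreal_inj) auto
    qed
    have p: "(\<integral>w. max 0 (f w) \<partial>B z) + r z * (\<integral>w. max 0 (f w) \<partial>E z) =
        (\<integral>w. max 0 (f w) \<partial>M z) + r z * max 0 (f z)"
      by (rule nonneg) (use elim in auto)
    have n: "(\<integral>w. max 0 (- f w) \<partial>B z) + r z * (\<integral>w. max 0 (- f w) \<partial>E z) =
        (\<integral>w. max 0 (- f w) \<partial>M z) + r z * max 0 (- f z)"
      by (rule nonneg) (use elim in auto)
    have parts: "(\<integral>w. f w \<partial>N) = (\<integral>w. max 0 (f w) \<partial>N) - (\<integral>w. max 0 (- f w) \<partial>N)"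
      if "integrable N f" for N
    proof -
      have "f = (\<lambda>w. max 0 (f w) - max 0 (- f w))" by (auto simp: max_def)
      then have "(\<integral>w. f w \<partial>N) = (\<integral>w. max 0 (f w) - max 0 (- f w) \<partial>N)" by metis
      also have "\<dots> = (\<integral>w. max 0 (f w) \<partial>N) - (\<integral>w. max 0 (- f w) \<partial>N)"
        using that by (intro Bochner_Integration.integral_diff) auto
      finally show ?thesis .
    qed
    have "f z = max 0 (f z) - max 0 (- f z)" by auto
    then have "r z * f z = r z * max 0 (f z) - r z * max 0 (- f z)"
      by (metis right_diff_distrib)
    then show ?case
      unfolding kernel_op_def parts[OF elim(1)] parts[OF elim(2)] parts[OF elim(3)] right_diff_distrib
      using p n by linarith
  qed
qed

text \<open>
  Functions of \<open>r\<close> are known under the conditioning and can be taken out of the conditional expectation.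
\<close>

lemma PE_hold_mult:
  assumes f[measurable]: "f \<in> borel_measurable \<pi>" and \<phi>[measurable]: "\<phi> \<in> borel_measurable borel"
    and z: "z \<in> space \<pi>"
  shows "PE (\<lambda>w. \<phi> (r w) * f w) z = \<phi> (r z) * PE f z"
proof -
  note mE = measurable_cong_sets[OF E.sets_K[OF z] refl]
  have "(\<integral>w. \<phi> (r w) * f w \<partial>E z) = (\<integral>w. \<phi> (r z) * f w \<partial>E z)"
  proof (rule integral_cong_AE)
    show "AE w in E z. \<phi> (r w) * f w = \<phi> (r z) * f w"
      using hold_invariant[OF z] by eventually_elim simp
  qed (unfold mE, measurable)
  then show ?thesis by (simp add: kernel_op_def)
qed

text \<open>
  On the kernel of \<open>E\<close>, \<open>M = B E\<close> vanishes, so that of \<open>B = M + r (1 - E)\<close> only the multiplication by \<open>r\<close> is left.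
\<close>

lemma PB_kernel_of_PE:
  assumes f: "f \<in> square_integrable \<pi>" and 0: "AE z in \<pi>. PE f z = 0"
  shows "AE z in \<pi>. PB f z = r z * f z" and "AE z in \<pi>. PM f z = 0"
proof -
  have i: "integrable \<pi> f" by (rule E.integrable_square_integrable[OF f])
  have [measurable]: "f \<in> borel_measurable \<pi>" by (rule square_integrableD[OF f])
  have "AE z in \<pi>. PB (PE f) z = PB (\<lambda>_. 0) z"
    by (rule B.kernel_op_cong_AE) (use 0 in auto)
  with PM_eq_PB_PE[OF i] show PM0: "AE z in \<pi>. PM f z = 0"
    by eventually_elim (simp add: kernel_op_def)
  show "AE z in \<pi>. PB f z = r z * f z"
    using PB_eq_PM_plus_hold[OF i] 0 PM0 by eventually_elim simp
qed

lemma PB_on_range_of_PE: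
  assumes f: "f \<in> square_integrable \<pi>" and fixed: "AE z in \<pi>. PE f z = f z"
  shows "AE z in \<pi>. PB f z = PM f z"
proof -
  have i: "integrable \<pi> f" by (rule E.integrable_square_integrable[OF f])
  show ?thesis using PB_eq_PM_plus_hold[OF i] fixed by eventually_elim simp
qed

lemma PE_residual:
  assumes f: "f \<in> square_integrable \<pi>"
  shows "AE z in \<pi>. PE (\<lambda>z. f z - PE f z) z = 0"
proof -
  have i: "integrable \<pi> f" by (rule E.integrable_square_integrable[OF f])
  show ?thesis
    using E.kernel_op_diff[OF i E.integrable_kernel_op[OF i]] PE_idem[OF i] by eventually_elim simp
qed

lemma residual_square_integrable:
  "f \<in> square_integrable \<pi> \<Longrightarrow> (\<lambda>z. f z - PE f z) \<in> square_integrable \<pi>"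
  by (intro square_integrable_diff E.square_integrable_kernel_op)

lemma hold_power_residual:
  assumes f: "f \<in> square_integrable \<pi>"
  shows "(\<lambda>z. r z ^ k * (f z - PE f z)) \<in> square_integrable \<pi>"
    and "AE z in \<pi>. PE (\<lambda>z. r z ^ k * (f z - PE f z)) z = 0"
proof -
  note res = residual_square_integrable[OF f]
  show "(\<lambda>z. r z ^ k * (f z - PE f z)) \<in> square_integrable \<pi>"
    by (rule square_integrable_bounded_mult[OF res, where b=1])
       (auto simp: power_le_one hold_nonneg hold_le_1)
  show "AE z in \<pi>. PE (\<lambda>z. r z ^ k * (f z - PE f z)) z = 0"
    using PE_residual[OF f] AE_space
  proof eventually_elim
    case (elim z)
    show ?case
      using PE_hold_mult[OF square_integrableD(1)[OF res], of "\<lambda>x. x ^ k"] elim by simp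
  qed
qed

text \<open>
  Both summands on the right keep their nature under \<open>B\<close>: for a positive power, \<open>M\<^sup>k f\<close> lies in the range of \<open>E\<close>, where \<open>B\<close> and \<open>M\<close>
  coincide, and \<open>r\<^sup>k (f - E f)\<close> lies in the kernel of \<open>E\<close>, where \<open>B\<close> is multiplication by \<open>r\<close>.  At power zero
  the formula would add a spurious \<open>f - E f\<close>.
\<close>

lemma PB_funpow:
  assumes f: "f \<in> square_integrable \<pi>"
  shows "AE z in \<pi>. (PB ^^ Suc k) f z = (PM ^^ Suc k) f z + r z ^ Suc k * (f z - PE f z)"
proof (induction k)
  case 0
  show ?case using PB_eq_PM_plus_hold[OF E.integrable_square_integrable[OF f]] by simp
next
  case (Suc k)
  let ?u = "(PM ^^ Suc k) f" and ?d = "\<lambda>z. r z ^ Suc k * (f z - PE f z)"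
  note PBk = B.kernel_op_funpow_square_integrable[OF f, of "Suc k"]
  note u = M.kernel_op_funpow_square_integrable[OF f, of "Suc k"]
  note u' = M.kernel_op_funpow_square_integrable[OF f, of k]
  note d = hold_power_residual[OF f, of "Suc k"]
  note int = E.integrable_square_integrable
  have PBu': "integrable \<pi> (PB ((PM ^^ k) f))" by (rule B.integrable_kernel_op[OF int[OF u']])
  have "AE z in \<pi>. PE ?u z = ?u z"
  proof -
    have a: "AE z in \<pi>. ?u z = PE (PB ((PM ^^ k) f)) z"
      using PM_eq_PE_PB[OF int[OF u']] by simp
    then have "AE z in \<pi>. PE ?u z = PE (PE (PB ((PM ^^ k) f))) z"
      using square_integrableD(1)[OF u] square_integrableD(1)[OF u']
      by (intro E.kernel_op_cong_AE) auto
    with a PE_idem[OF PBu'] show ?thesis by eventually_elim simp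
  qed
  then have range: "AE z in \<pi>. PB ?u z = PM ?u z" by (rule PB_on_range_of_PE[OF u])
  have "AE z in \<pi>. PB ((PB ^^ Suc k) f) z = PB (\<lambda>z. ?u z + ?d z) z"
    using square_integrableD(1)[OF PBk] square_integrableD(1)[OF u] square_integrableD(1)[OF d(1)]
    by (intro B.kernel_op_cong_AE Suc.IH) auto
  moreover have "AE z in \<pi>. PB (\<lambda>z. ?u z + ?d z) z = PB ?u z + PB ?d z"
    by (rule B.kernel_op_add[OF int[OF u] int[OF d(1)]])
  ultimately show ?case
    using range PB_kernel_of_PE(1)[OF d] by eventually_elim simp
qed

text \<open>
  The difference at a positive lag is \<open>\<integral> f r\<^sup>k (f - E f)\<close>.  Since \<open>r\<^sup>k (f - E f)\<close> is orthogonal to the range of \<open>E\<close>, the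
  first factor \<open>f\<close> may be replaced by \<open>f - E f\<close>, and the integrand becomes nonnegative.
\<close>

lemma autocov_le:
  assumes f: "f \<in> square_integrable \<pi>"
  shows "M.autocov f k \<le> B.autocov f k"
proof (cases k)
  case (Suc j)
  let ?d = "\<lambda>z. r z ^ k * (f z - PE f z)"
  note d = hold_power_residual[OF f, of k]
  note res = residual_square_integrable[OF f]
  note PMk = M.kernel_op_funpow_square_integrable[OF f, of k]
  note PBk = B.kernel_op_funpow_square_integrable[OF f, of k]
  note PEf = E.square_integrable_kernel_op[OF f]
  note prod = integrable_mult_square_integrable
  have [measurable]: "f \<in> borel_measurable \<pi>" "?d \<in> borel_measurable \<pi>"
      "(PM ^^ k) f \<in> borel_measurable \<pi>" "(PB ^^ k) f \<in> borel_measurable \<pi>"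
    using f d(1) PMk PBk by (auto simp only: square_integrable_def)
  have "B.autocov f k = (\<integral>z. f z * (PM ^^ k) f z + f z * ?d z \<partial>\<pi>)"
    unfolding B.autocov_def
  proof (rule integral_cong_AE)
    show "AE z in \<pi>. f z * (PB ^^ k) f z = f z * (PM ^^ k) f z + f z * ?d z"
      using PB_funpow[OF f, of j] unfolding Suc by eventually_elim (simp add: distrib_left)
  qed measurable
  also have "\<dots> = M.autocov f k + (\<integral>z. f z * ?d z \<partial>\<pi>)"
    unfolding M.autocov_def by (rule Bochner_Integration.integral_add[OF prod[OF f PMk] prod[OF f d(1)]])
  also have "(\<integral>z. f z * ?d z \<partial>\<pi>) = (\<integral>z. (f z - PE f z) * ?d z \<partial>\<pi>) + (\<integral>z. ?d z * PE f z \<partial>\<pi>)"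
    using Bochner_Integration.integral_add[OF prod[OF res d(1)] prod[OF d(1) PEf]]
    by (simp add: algebra_simps)
  also have "(\<integral>z. ?d z * PE f z \<partial>\<pi>) = (\<integral>z. f z * PE ?d z \<partial>\<pi>)"
    by (rule E.kernel_op_symmetric[OF d(1) f])
  also have "\<dots> = (\<integral>z. 0 \<partial>\<pi>)"
    by (rule integral_cong_AE) (use d(2) in \<open>auto elim!: eventually_mono\<close>)
  finally have "B.autocov f k = M.autocov f k + (\<integral>z. (f z - PE f z) * ?d z \<partial>\<pi>)" by simp
  moreover have "0 \<le> (\<integral>z. (f z - PE f z) * ?d z \<partial>\<pi>)"
  proof (rule Bochner_Integration.integral_nonneg)
    show "0 \<le> (f z - PE f z) * ?d z" for z
      using mult_nonneg_nonneg[OF zero_le_power[OF hold_nonneg[of z], of k] zero_le_power2[of "f z - PE f z"]]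
      by (simp add: power2_eq_square mult_ac)
  qed
  ultimately show ?thesis by linarith
qed (simp add: M.autocov_def B.autocov_def)

theorem asymp_var_refreshed_le:
  assumes f: "f \<in> square_integrable \<pi>"
  shows "asymp_var \<pi> M f \<le> asymp_var \<pi> B f"
proof (rule LIMSEQ_le[OF M.scaled_variance_tendsto_asymp_var[OF f] B.scaled_variance_tendsto_asymp_var[OF f]],
    intro exI allI impI)
  fix T :: nat assume T: "1 \<le> T"
  have g: "(\<lambda>z. f z - (\<integral>w. f w \<partial>\<pi>)) \<in> square_integrable \<pi>"
    by (intro square_integrable_diff f E.square_integrable_const)
  show "ereal (real T * variance_of (chain_law \<pi> M) (\<lambda>\<omega>. (1 / real T) * (\<Sum>t = 1..T. f (\<omega> t)))) \<le>
      ereal (real T * variance_of (chain_law \<pi> B) (\<lambda>\<omega>. (1 / real T) * (\<Sum>t = 1..T. f (\<omega> t))))"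
    unfolding M.scaled_variance_eq_autocov_sum[OF f T] B.scaled_variance_eq_autocov_sum[OF f T] ereal_less_eq
    by (intro divide_right_mono sum_mono autocov_le[OF g]) simp
qed

text \<open>
  To solve \<open>s h' - M h' = g\<close>, solve \<open>s h - B h = E g\<close> and take \<open>h' = E h + (g - E g) / s\<close>: the first term is
  in the range of \<open>E\<close>, where \<open>M\<close> acts as \<open>B\<close>, the second in its kernel, where \<open>M\<close> is zero.  The lower bound follows
  in the same way by estimating \<open>E h\<close> and \<open>h - E h\<close> separately.
\<close>

lemma regular_value0_transfer:
  assumes s: "s \<noteq> 0" and regB: "regular_value0 \<pi> B s"
  shows "regular_value0 \<pi> M s"
  unfolding regular_value0_iff
proof (intro conjI ballI)
  fix g assume g: "g \<in> mean_zero \<pi>"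
  then have g2: "g \<in> square_integrable \<pi>" by (simp add: mean_zero_def)
  note int = E.integrable_square_integrable
  note PEg = E.kernel_op_mean_zero[OF g]
  from regB PEg obtain h where h: "h \<in> mean_zero \<pi>"
    and eq: "AE z in \<pi>. s * h z - PB h z = PE g z"
    unfolding regular_value0_def by blast
  have h2: "h \<in> square_integrable \<pi>" using h by (simp add: mean_zero_def)
  have [measurable]: "h \<in> borel_measurable \<pi>" "g \<in> borel_measurable \<pi>"
    using h2 g2 by (auto simp: square_integrable_def)
  have ih: "integrable \<pi> h" and ig: "integrable \<pi> g" by (rule int[OF h2], rule int[OF g2])
  note iPEh = E.integrable_kernel_op[OF ih] and iPEg = E.integrable_kernel_op[OF ig]
  let ?h = "\<lambda>z. PE h z + (1 / s) * (g z - PE g z)"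
  have res: "(\<lambda>z. (1 / s) * (g z - PE g z)) \<in> square_integrable \<pi>"
    by (intro square_integrable_cmult residual_square_integrable g2)
  have h': "?h \<in> mean_zero \<pi>"
    using E.square_integrable_kernel_op[OF h2] res h g iPEh iPEg ig
    by (auto simp: mean_zero_def E.integral_kernel_op[OF ih] E.integral_kernel_op[OF ig])
  have "AE z in \<pi>. s * ?h z - PM ?h z = g z"
  proof -
    have 1: "AE z in \<pi>. PM ?h z = PM (PE h) z + PM (\<lambda>z. (1 / s) * (g z - PE g z)) z"
      by (rule M.kernel_op_add[OF iPEh int[OF res]])
    have 2: "AE z in \<pi>. PM (\<lambda>z. g z - PE g z) z = 0"
      by (rule PB_kernel_of_PE(2)[OF residual_square_integrable[OF g2] PE_residual[OF g2]])
    have 3: "AE z in \<pi>. PM (PE h) z = PM h z"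
    proof -
      have "AE z in \<pi>. PB (PE (PE h)) z = PB (PE h) z"
        by (rule B.kernel_op_cong_AE) (use PE_idem[OF ih] in \<open>auto elim!: eventually_mono\<close>)
      with PM_eq_PB_PE[OF iPEh] PM_eq_PB_PE[OF ih] show ?thesis by eventually_elim simp
    qed
    have 4: "AE z in \<pi>. PE (\<lambda>z. s * h z - PB h z) z = PE (PE g) z"
      by (rule E.kernel_op_cong_AE) (use eq in auto)
    have 5: "AE z in \<pi>. PE (\<lambda>z. s * h z - PB h z) z = s * PE h z - PE (PB h) z"
      using E.kernel_op_diff[OF integrable_mult_right[OF ih, of s] B.integrable_kernel_op[OF ih]]
      by (simp add: E.kernel_op_cmult)
    show ?thesis
      using 1 2 3 4 5 PE_idem[OF ig] PM_eq_PE_PB[OF ih]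
    proof eventually_elim
      case (elim z)
      have "PM (\<lambda>z. (1 / s) * (g z - PE g z)) z = 0"
        unfolding M.kernel_op_cmult elim(2) by simp
      with elim have "PM ?h z = s * PE h z - PE g z" by linarith
      moreover have "s * (PE h z + (1 / s) * (g z - PE g z)) = s * PE h z + (g z - PE g z)"
        using s by (simp add: distrib_left)
      ultimately show ?case by linarith
    qed
  qed
  then show "\<exists>h \<in> mean_zero \<pi>. AE z in \<pi>. s * h z - PM h z = g z"
    by (rule bexI[of _ ?h, OF _ h'])
next
  from regB obtain C where C: "\<And>h. h \<in> mean_zero \<pi> \<Longrightarrow>
      L2_norm \<pi> h \<le> C * L2_norm \<pi> (\<lambda>z. s * h z - PB h z)"
    unfolding regular_value0_def by blast
  \<comment> \<open>With \<open>u = s h - M h\<close> one gets \<open>\<parallel>E h\<parallel>\<^sup>2 \<le> C\<^sup>2 \<parallel>u\<parallel>\<^sup>2\<close> from \<open>B\<close> and \<open>\<parallel>h - E h\<parallel>\<^sup>2 \<le> (4 / s\<^sup>2) \<parallel>u\<parallel>\<^sup>2\<close> from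
    \<open>s (h - E h) = u - E u\<close>; adding the two parts costs another factor of two.\<close>
  define D where "D = sqrt (2 * C\<^sup>2 + 8 / s\<^sup>2)"
  have D: "D\<^sup>2 = 2 * C\<^sup>2 + 8 / s\<^sup>2" "0 \<le> D" by (simp_all add: D_def)
  have "L2_norm \<pi> h \<le> D * L2_norm \<pi> (\<lambda>z. s * h z - PM h z)" if h: "h \<in> mean_zero \<pi>" for h
    unfolding L2_norm_le_iff[OF D(2)]
  proof -
    have h2: "h \<in> square_integrable \<pi>" using h by (simp add: mean_zero_def)
    let ?u = "\<lambda>z. s * h z - PM h z"
    have u: "?u \<in> square_integrable \<pi>"
      by (intro square_integrable_diff square_integrable_cmult h2 M.square_integrable_kernel_op)
    have [measurable]: "h \<in> borel_measurable \<pi>" "?u \<in> borel_measurable \<pi>"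
      using h2 u by (auto simp: square_integrable_def)
    have ih: "integrable \<pi> h" by (rule E.integrable_square_integrable[OF h2])
    note PEh = E.square_integrable_kernel_op[OF h2] and PEu = E.square_integrable_kernel_op[OF u]
    let ?n = "\<lambda>f :: 'z \<Rightarrow> real. \<integral>z. (f z)\<^sup>2 \<partial>\<pi>"
    have PEu_eq: "AE z in \<pi>. PE ?u z = s * PE h z - PB (PE h) z"
    proof -
      have 1: "AE z in \<pi>. PE ?u z = s * PE h z - PE (PM h) z"
        using E.kernel_op_diff[OF integrable_mult_right[OF ih, of s] M.integrable_kernel_op[OF ih]]
        by (simp add: E.kernel_op_cmult)
      have 2: "AE z in \<pi>. PE (PM h) z = PE (PE (PB h)) z"
        by (rule E.kernel_op_cong_AE) (use PM_eq_PE_PB[OF ih] in auto)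
      show ?thesis
        using 1 2 PE_idem[OF B.integrable_kernel_op[OF ih]] PM_eq_PE_PB[OF ih] PM_eq_PB_PE[OF ih]
        by eventually_elim simp
    qed
    have "L2_norm \<pi> (PE h) \<le> C * L2_norm \<pi> (\<lambda>z. s * PE h z - PB (PE h) z)"
      by (rule C[OF E.kernel_op_mean_zero[OF h]])
    also have "\<dots> \<le> \<bar>C\<bar> * L2_norm \<pi> (\<lambda>z. s * PE h z - PB (PE h) z)"
      by (intro mult_right_mono) (auto simp: L2_norm_def)
    finally have "?n (PE h) \<le> C\<^sup>2 * ?n (\<lambda>z. s * PE h z - PB (PE h) z)"
      by (subst (asm) L2_norm_le_iff) auto
    also have "?n (\<lambda>z. s * PE h z - PB (PE h) z) = ?n (PE ?u)"
      by (rule integral_cong_AE) (use PEu_eq in \<open>auto elim!: eventually_mono\<close>)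
    also have "C\<^sup>2 * ?n (PE ?u) \<le> C\<^sup>2 * ?n ?u"
      by (intro mult_left_mono E.integral_square_kernel_op_le[OF u]) simp
    finally have range: "?n (PE h) \<le> C\<^sup>2 * ?n ?u" .
    have res_eq: "AE z in \<pi>. ?u z + (- 1) * PE ?u z = s * (h z - PE h z)"
      using PEu_eq PM_eq_PB_PE[OF ih] by eventually_elim (simp add: right_diff_distrib)
    have "s\<^sup>2 * ?n (\<lambda>z. h z - PE h z) = ?n (\<lambda>z. s * (h z - PE h z))"
      by (simp add: power_mult_distrib)
    also have "\<dots> = ?n (\<lambda>z. ?u z + (- 1) * PE ?u z)"
      by (rule integral_cong_AE) (use res_eq in \<open>auto elim!: eventually_mono\<close>)
    also have "\<dots> \<le> 2 * ?n ?u + 2 * ?n (\<lambda>z. (- 1) * PE ?u z)"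
      by (rule integral_square_add_le[OF u square_integrable_cmult[OF PEu]])
    also have "\<dots> \<le> 4 * ?n ?u"
      using E.integral_square_kernel_op_le[OF u] by simp
    finally have res: "?n (\<lambda>z. h z - PE h z) \<le> 4 / s\<^sup>2 * ?n ?u"
      using s by (simp add: field_simps)
    have "?n h = ?n (\<lambda>z. PE h z + (h z - PE h z))" by simp
    also have "\<dots> \<le> 2 * ?n (PE h) + 2 * ?n (\<lambda>z. h z - PE h z)"
      by (rule integral_square_add_le[OF PEh residual_square_integrable[OF h2]])
    also have "\<dots> \<le> D\<^sup>2 * ?n ?u"
      using range res unfolding D by (simp add: distrib_right)
    finally show "?n h \<le> D\<^sup>2 * ?n ?u" .
  qed
  then show "\<exists>C. \<forall>h \<in> mean_zero \<pi>. L2_norm \<pi> h \<le> C * L2_norm \<pi> (\<lambda>z. s * h z - PM h z)" by blast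
qed

context
  fixes \<phi> :: "'z \<Rightarrow> real"
  assumes \<phi>: "\<phi> \<in> square_integrable \<pi>" "AE z in \<pi>. PE \<phi> z = 0" "AE z in \<pi>. \<phi> z \<noteq> 0"
begin

lemma mean_zero_of_PE_zero:
  assumes f: "f \<in> square_integrable \<pi>" and 0: "AE z in \<pi>. PE f z = 0"
  shows "f \<in> mean_zero \<pi>"
proof -
  have "(\<integral>z. f z \<partial>\<pi>) = (\<integral>z. PE f z \<partial>\<pi>)"
    by (rule E.integral_kernel_op[OF E.integrable_square_integrable[OF f], symmetric])
  also have "\<dots> = (\<integral>z. 0 \<partial>\<pi>)"
    using square_integrableD(1)[OF f] 0 by (intro integral_cong_AE) auto
  finally show ?thesis using f by (simp add: mean_zero_def)
qed

lemma zero_in_spectrum0_refreshed: "0 \<in> spectrum0 \<pi> M"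
proof -
  have "\<not> (AE z in \<pi>. \<phi> z = 0)"
  proof
    assume "AE z in \<pi>. \<phi> z = 0"
    with \<phi>(3) have "AE z in \<pi>. False" by eventually_elim simp
    then show False using E.AE_False by simp
  qed
  moreover have "AE z in \<pi>. 0 * \<phi> z - PM \<phi> z = 0"
    using PB_kernel_of_PE(2)[OF \<phi>(1,2)] by simp
  ultimately show ?thesis
    using mean_zero_of_PE_zero[OF \<phi>(1,2)] by (auto simp: spectrum0_def regular_value0_def)
qed

text \<open>
  The essential supremum \<open>s\<close> of \<open>r\<close> is an approximate eigenvalue of \<open>B\<close>: restricting \<open>\<phi>\<close> to the set where
  \<open>r > s - e\<close> stays in the kernel of \<open>E\<close>, since \<open>r\<close> is known under the conditioning, and on such functions \<open>s - B\<close> is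
  multiplication by \<open>s - r\<close>, which has modulus at most \<open>e\<close> there.
\<close>

lemma spectrum0_nonneg_point: "\<exists>s \<ge> 0. s \<in> spectrum0 \<pi> B"
proof -
  define S where "S = {t. AE z in \<pi>. r z \<le> t}"
  have S1: "1 \<in> S" by (simp add: S_def hold_le_1)
  have S0: "0 \<le> t" if "t \<in> S" for t
  proof (rule ccontr)
    assume "\<not> 0 \<le> t"
    from that have "AE z in \<pi>. r z \<le> t" by (simp add: S_def)
    then have "AE z in \<pi>. False"
    proof eventually_elim
      case (elim z)
      then show ?case using hold_nonneg[of z] \<open>\<not> 0 \<le> t\<close> by linarith
    qed
    then show False using E.AE_False by simp
  qed
  have bdd: "bdd_below S" using S0 by (intro bdd_belowI) auto
  define s where "s = Inf S"
  have s0: "0 \<le> s" unfolding s_def using S1 S0 by (intro cInf_greatest) auto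
  have "\<not> regular_value0 \<pi> B s"
  proof
    assume "regular_value0 \<pi> B s"
    then obtain C where C: "\<And>h. h \<in> mean_zero \<pi> \<Longrightarrow>
        L2_norm \<pi> h \<le> C * L2_norm \<pi> (\<lambda>z. s * h z - PB h z)"
      unfolding regular_value0_def by blast
    \<comment> \<open>Any positive \<open>e\<close> with \<open>\<bar>C\<bar> * e < 1\<close> contradicts the lower bound with constant \<open>C\<close>.\<close>
    define e where "e = 1 / (2 * (\<bar>C\<bar> + 1))"
    have e: "0 < e" by (simp add: e_def)
    have upper: "AE z in \<pi>. r z \<le> s + e"
    proof -
      obtain t where t: "t \<in> S" "t < s + e"
        using cInf_lessD[of S "s + e"] S1 e by (auto simp: s_def)
      then have "AE z in \<pi>. r z \<le> t" by (simp add: S_def)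
      then show ?thesis by eventually_elim (use t in simp)
    qed
    have lower: "\<not> (AE z in \<pi>. r z \<le> s - e)"
      using cInf_lower[OF _ bdd, of "s - e"] e by (auto simp: s_def S_def)
    define i where "i x = (indicator {s - e <..} x :: real)" for x
    have [measurable]: "i \<in> borel_measurable borel" unfolding i_def[abs_def] by measurable
    have \<phi>m[measurable]: "\<phi> \<in> borel_measurable \<pi>" by (rule square_integrableD[OF \<phi>(1)])
    let ?h = "\<lambda>z. i (r z) * \<phi> z"
    have h2: "?h \<in> square_integrable \<pi>"
      by (rule square_integrable_bounded_mult[OF \<phi>(1), where b=1]) (auto simp: i_def)
    have PEh: "AE z in \<pi>. PE ?h z = 0"
      using \<phi>(2) AE_space by eventually_elim (simp add: PE_hold_mult)
    have h: "?h \<in> mean_zero \<pi>" by (rule mean_zero_of_PE_zero[OF h2 PEh])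
    let ?u = "\<lambda>z. s * ?h z - PB ?h z"
    have u2: "?u \<in> square_integrable \<pi>"
      by (intro square_integrable_diff square_integrable_cmult h2 B.square_integrable_kernel_op)
    have "(\<integral>z. (?u z)\<^sup>2 \<partial>\<pi>) \<le> (\<integral>z. e\<^sup>2 * (?h z)\<^sup>2 \<partial>\<pi>)"
    proof (rule integral_mono_AE)
      show "integrable \<pi> (\<lambda>z. (?u z)\<^sup>2)" by (rule square_integrableD[OF u2])
      show "integrable \<pi> (\<lambda>z. e\<^sup>2 * (?h z)\<^sup>2)" using square_integrableD(2)[OF h2] by simp
      show "AE z in \<pi>. (?u z)\<^sup>2 \<le> e\<^sup>2 * (?h z)\<^sup>2"
        using PB_kernel_of_PE(1)[OF h2 PEh] upper
      proof eventually_elim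
        case (elim z)
        have "?u z = (s - r z) * ?h z" by (simp add: elim(1) left_diff_distrib)
        moreover have "(s - r z)\<^sup>2 * (?h z)\<^sup>2 \<le> e\<^sup>2 * (?h z)\<^sup>2"
        proof (cases "s - e < r z")
          case True
          then have "\<bar>s - r z\<bar> \<le> e" using elim(2) by simp
          then have "(s - r z)\<^sup>2 \<le> e\<^sup>2" using power_mono[of "\<bar>s - r z\<bar>" e 2] by simp
          then show ?thesis by (intro mult_right_mono) auto
        qed (simp add: i_def)
        ultimately show ?case by (simp add: power_mult_distrib)
      qed
    qed
    then have "L2_norm \<pi> ?u \<le> e * L2_norm \<pi> ?h"
      using e by (subst L2_norm_le_iff) auto
    then have "\<bar>C\<bar> * L2_norm \<pi> ?u \<le> \<bar>C\<bar> * (e * L2_norm \<pi> ?h)"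
      by (intro mult_left_mono) auto
    moreover have "C * L2_norm \<pi> ?u \<le> \<bar>C\<bar> * L2_norm \<pi> ?u"
      by (intro mult_right_mono) (auto simp: L2_norm_def)
    ultimately have "L2_norm \<pi> ?h \<le> (\<bar>C\<bar> * e) * L2_norm \<pi> ?h"
      using C[OF h] by simp
    moreover have "\<bar>C\<bar> * e < 1" by (simp add: e_def field_simps)
    moreover have "0 \<le> L2_norm \<pi> ?h" by (simp add: L2_norm_def)
    ultimately have "L2_norm \<pi> ?h = 0"
      by (smt (verit) mult_less_cancel_right1 mult_le_cancel_right1)
    then have "(\<integral>z. (?h z)\<^sup>2 \<partial>\<pi>) = 0" by (simp add: L2_norm_def)
    then have "AE z in \<pi>. (?h z)\<^sup>2 = 0"
      using square_integrableD(2)[OF h2] by (subst (asm) integral_nonneg_eq_0_iff_AE) auto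
    with \<phi>(3) have "AE z in \<pi>. r z \<le> s - e"
      by eventually_elim (auto simp: i_def split: split_indicator_asm)
    with lower show False by blast
  qed
  with s0 show ?thesis by (auto simp: spectrum0_def)
qed

theorem right_gap_refreshed_ge: "right_gap \<pi> B \<le> right_gap \<pi> M"
proof -
  obtain s0 where s0: "0 \<le> s0" "s0 \<in> spectrum0 \<pi> B" using spectrum0_nonneg_point by blast
  have "Sup (spectrum0 \<pi> M) \<le> Sup (spectrum0 \<pi> B)"
  proof (rule cSup_least)
    show "spectrum0 \<pi> M \<noteq> {}" using zero_in_spectrum0_refreshed by blast
    fix s assume s: "s \<in> spectrum0 \<pi> M"
    show "s \<le> Sup (spectrum0 \<pi> B)"
    proof (cases "s = 0")
      case True
      then show ?thesis
        using s0 cSup_upper[OF s0(2) B.bdd_above_spectrum0] by simp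
    next
      case False
      then have "s \<in> spectrum0 \<pi> B"
        using s regular_value0_transfer by (auto simp: spectrum0_def)
      then show ?thesis by (rule cSup_upper[OF _ B.bdd_above_spectrum0])
    qed
  qed
  then show ?thesis by (simp add: right_gap_def)
qed

end

end

section \<open>The MarCo and OneBlockMH kernels\<close>

lemma measurable_prob_algebraI:
  assumes "\<And>x. x \<in> space M \<Longrightarrow> prob_space (K x)" "\<And>x. x \<in> space M \<Longrightarrow> sets (K x) = sets N"
    and "\<And>A. A \<in> sets N \<Longrightarrow> (\<lambda>x. emeasure (K x) A) \<in> borel_measurable M"
  shows "K \<in> M \<rightarrow>\<^sub>M prob_algebra N"
  by (rule measurable_prob_algebra_generated[OF sets.sigma_sets_eq[symmetric] sets.Int_stable sets.space_closed])
     (use assms in auto)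

lemma AE_lborel_inner_neq:
  fixes b :: "'a::euclidean_space"
  assumes b: "b \<in> Basis"
  shows "AE x in lborel. x \<bullet> b \<noteq> t"
proof -
  have "closed {x. x \<bullet> b = t}"
    by (intro closed_Collect_eq continuous_intros)
  then have "{x. x \<bullet> b = t} \<in> sets lborel" by simp
  moreover have "{x. x \<bullet> b = t} \<in> null_sets lebesgue"
    using negligible_standard_hyperplane[OF b, of t] by (simp add: negligible_iff_null_sets)
  ultimately have "{x. x \<bullet> b = t} \<in> null_sets lborel"
    by (simp add: null_sets_completion_iff)
  from AE_not_in[OF this] show ?thesis by simp
qed

locale marginal_metropolis =
  fixes c :: "'b::euclidean_space \<Rightarrow> 'a::euclidean_space \<Rightarrow> real"
    and p :: "'b \<Rightarrow> real" and q :: "'b \<Rightarrow> 'b \<Rightarrow> real"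
    and \<pi> :: "('a \<times> 'b) measure"
  assumes cond: "conditional_density c" and proposal: "conditional_density q"
    and p_measurable[measurable]: "p \<in> borel_measurable borel" and p_nonneg: "\<And>y. 0 \<le> p y"
    and prob_joint: "prob_space \<pi>"
    and joint: "\<pi> = density lborel (\<lambda>y. ennreal (p y)) \<bind>
                  (\<lambda>y. distr (cond_dist c y) borel (\<lambda>x. (x, y)))"
begin

text \<open>
  The conditional distribution given \<open>y\<close>, regarded as a measure on pairs that is carried by the fibre over \<open>y\<close>.
\<close>

definition fibre :: "'b \<Rightarrow> ('a \<times> 'b) measure" where
  "fibre y = distr (cond_dist c y) borel (\<lambda>x. (x, y))"

lemma c_measurable[measurable]: "(\<lambda>z. c (fst z) (snd z)) \<in> borel_measurable (borel \<Otimes>\<^sub>M borel)"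
  using cond by (simp add: conditional_density_def case_prod_beta' borel_prod)

lemma q_measurable[measurable]: "(\<lambda>z. q (fst z) (snd z)) \<in> borel_measurable (borel \<Otimes>\<^sub>M borel)"
  using proposal by (simp add: conditional_density_def case_prod_beta' borel_prod)

lemma c_section_measurable[measurable]: "c y \<in> borel_measurable borel"
  using measurable_compose[OF measurable_Pair1' c_measurable, of y] by simp

lemma Pair_measurable[measurable]: "(\<lambda>x :: 'a. (x, y :: 'b)) \<in> borel_measurable borel"
  unfolding borel_prod[symmetric] by measurable

lemma sets_cond_dist: "sets (cond_dist c y) = sets borel"
  by (simp add: cond_dist_def)

lemma Pair_measurable_cond_dist: "(\<lambda>x. (x, y)) \<in> cond_dist c y \<rightarrow>\<^sub>M borel"
  by (simp add: measurable_cong_sets[OF sets_cond_dist refl])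

lemma sets_fibre: "sets (fibre y) = sets borel" by (simp add: fibre_def)

lemma prob_space_fibre: "prob_space (fibre y)"
proof -
  have "prob_space (cond_dist c y)"
    using cond by (intro prob_spaceI) (simp add: cond_dist_def emeasure_density conditional_density_def)
  then show ?thesis
    unfolding fibre_def by (rule prob_space.prob_space_distr[OF _ Pair_measurable_cond_dist])
qed

lemma emeasure_fibre:
  "A \<in> sets borel \<Longrightarrow> emeasure (fibre y) A = emeasure (cond_dist c y) {x. (x, y) \<in> A}"
  unfolding fibre_def
  by (subst emeasure_distr[OF Pair_measurable_cond_dist]) (auto simp: cond_dist_def vimage_def)

lemma measurable_fibre: "fibre \<in> borel \<rightarrow>\<^sub>M prob_algebra borel"
proof (rule measurable_prob_algebraI)
  fix A :: "('a \<times> 'b) set" assume A: "A \<in> sets borel"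
  then have A'[measurable]: "A \<in> sets (borel \<Otimes>\<^sub>M borel)" unfolding borel_prod .
  have "emeasure (fibre y) A = (\<integral>\<^sup>+x. ennreal (c y x) * indicator A (x, y) \<partial>lborel)" for y
  proof -
    have "{x. (x, y) \<in> A} \<in> sets borel"
      using measurable_sets[OF Pair_measurable A, of y] by (simp add: vimage_def)
    then show ?thesis
      unfolding emeasure_fibre[OF A] cond_dist_def
      by (subst emeasure_density) (auto simp: indicator_def intro!: nn_integral_cong)
  qed
  moreover have "(\<lambda>y. \<integral>\<^sup>+x. ennreal (c y x) * indicator A (x, y) \<partial>lborel) \<in> borel_measurable borel"
    by measurable
  ultimately show "(\<lambda>y. emeasure (fibre y) A) \<in> borel_measurable borel" by simp
qed (auto simp: prob_space_fibre sets_fibre)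

lemma measurable_fibre_sub[measurable]: "fibre \<in> borel \<rightarrow>\<^sub>M subprob_algebra borel"
  by (rule measurable_prob_algebraD[OF measurable_fibre])

lemma AE_fibre: "AE w in fibre y. snd w = y"
proof -
  have "closed {w :: 'a \<times> 'b. snd w = y}" by (intro closed_Collect_eq continuous_intros)
  then have "{w \<in> space borel. snd w = y} \<in> sets (borel :: ('a \<times> 'b) measure)" by simp
  from AE_distr_iff[OF Pair_measurable_cond_dist[of y] this] show ?thesis
    unfolding fibre_def by simp
qed

text \<open>
  Functions of the second coordinate are constant on a fibre.
\<close>

lemma nn_integral_fibre_snd:
  assumes F[measurable]: "F \<in> borel_measurable borel"
  shows "(\<integral>\<^sup>+w. F w * G (snd w) \<partial>fibre y) = (\<integral>\<^sup>+w. F w \<partial>fibre y) * (G y :: ennreal)"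
proof -
  have "(\<integral>\<^sup>+w. F w * G (snd w) \<partial>fibre y) = (\<integral>\<^sup>+w. F w * G y \<partial>fibre y)"
    by (rule nn_integral_cong_AE) (use AE_fibre[of y] in \<open>auto elim!: eventually_mono\<close>)
  also have "\<dots> = (\<integral>\<^sup>+w. F w \<partial>fibre y) * G y"
    by (rule nn_integral_multc) (simp add: measurable_cong_sets[OF sets_fibre refl])
  finally show ?thesis .
qed

lemma sets_joint: "sets \<pi> = sets borel"
  unfolding joint by (rule sets_bind) (auto simp: space_density)

lemma nn_integral_joint:
  assumes F[measurable]: "F \<in> borel_measurable borel"
  shows "(\<integral>\<^sup>+z. F z \<partial>\<pi>) = (\<integral>\<^sup>+y. ennreal (p y) * (\<integral>\<^sup>+w. F w \<partial>fibre y) \<partial>lborel)"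
proof -
  have "fibre \<in> density lborel (\<lambda>y. ennreal (p y)) \<rightarrow>\<^sub>M subprob_algebra borel"
    using measurable_fibre_sub by simp
  from nn_integral_bind[OF F this]
  have "(\<integral>\<^sup>+z. F z \<partial>\<pi>) = (\<integral>\<^sup>+y. (\<integral>\<^sup>+w. F w \<partial>fibre y) \<partial>density lborel (\<lambda>y. ennreal (p y)))"
    by (simp add: joint fibre_def[abs_def])
  also have "\<dots> = (\<integral>\<^sup>+y. ennreal (p y) * (\<integral>\<^sup>+w. F w \<partial>fibre y) \<partial>lborel)"
    by (rule nn_integral_density) measurable
  finally show ?thesis .
qed

text \<open>
  The density of the accepted moves of the marginal chain; it integrates to the acceptance probability.
\<close>

definition move :: "'b \<Rightarrow> 'b \<Rightarrow> real" where
  "move y y' = q y y' * accept_marg p q y y'"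

lemma q_nonneg: "0 \<le> q y y'" using proposal by (simp add: conditional_density_def)

lemma accept_bounds: "0 \<le> accept_marg p q y y'" "accept_marg p q y y' \<le> 1"
  by (auto simp: accept_marg_def p_nonneg q_nonneg)

lemma move_nonneg: "0 \<le> move y y'" by (simp add: move_def accept_bounds q_nonneg)

lemma move_le: "move y y' \<le> q y y'"
  using mult_left_mono[OF accept_bounds(2) q_nonneg] by (simp add: move_def)

text \<open>
  Both sides equal \<open>min (p y * q y y') (p y' * q y' y)\<close>.  This includes the case of a vanishing denominator, where
  the acceptance probability is one by convention but is multiplied by zero.
\<close>

lemma detailed_balance: "p y * move y y' = p y' * move y' y"
proof -
  have "p y * move y y' = min (p y * q y y') (p y' * q y' y)" for y y'
  proof (cases "p y * q y y' = 0")
    case True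
    then show ?thesis by (auto simp: move_def p_nonneg q_nonneg)
  next
    case False
    then have "0 < p y * q y y'" using p_nonneg[of y] q_nonneg[of y y'] by (simp add: less_le)
    with False show ?thesis
      by (auto simp: move_def accept_marg_def min_def field_simps)
  qed
  then show ?thesis by (simp add: min.commute)
qed

lemma move_measurable[measurable]: "(\<lambda>z. move (fst z) (snd z)) \<in> borel_measurable (borel \<Otimes>\<^sub>M borel)"
proof -
  have [measurable]: "(\<lambda>z. q (snd z) (fst z)) \<in> borel_measurable (borel \<Otimes>\<^sub>M borel)"
    using measurable_compose[OF measurable_Pair[OF measurable_snd measurable_fst] q_measurable] by simp
  show ?thesis unfolding move_def accept_marg_def by measurable
qed

lemma move_section_measurable[measurable]: "move y \<in> borel_measurable borel"
  using measurable_compose[OF measurable_Pair1' move_measurable, of y] by simp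

abbreviation hold :: "'b \<Rightarrow> real" where "hold \<equiv> reject_marg p q"

lemma
  shows hold_nonneg: "0 \<le> hold y" and hold_le_1: "hold y \<le> 1"
    and move_hold_total: "(\<integral>\<^sup>+y'. ennreal (move y y') \<partial>lborel) + ennreal (hold y) = 1"
proof -
  have le: "(\<integral>\<^sup>+y'. ennreal (move y y') \<partial>lborel) \<le> 1"
  proof -
    have "(\<integral>\<^sup>+y'. ennreal (move y y') \<partial>lborel) \<le> (\<integral>\<^sup>+y'. ennreal (q y y') \<partial>lborel)"
      by (intro nn_integral_mono ennreal_leI move_le)
    then show ?thesis using proposal by (simp add: conditional_density_def)
  qed
  have int: "integrable lborel (move y)"
    using le move_nonneg by (intro integrableI_nonneg) (auto intro: le_less_trans)
  have eq: "(\<integral>\<^sup>+y'. ennreal (move y y') \<partial>lborel) = ennreal (\<integral>y'. move y y' \<partial>lborel)"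
    using int move_nonneg by (intro nn_integral_eq_integral) auto
  have h: "hold y = 1 - (\<integral>y'. move y y' \<partial>lborel)" by (simp add: reject_marg_def move_def)
  show "0 \<le> hold y" using le unfolding h eq by simp
  show "hold y \<le> 1" unfolding h using move_nonneg by simp
  show "(\<integral>\<^sup>+y'. ennreal (move y y') \<partial>lborel) + ennreal (hold y) = 1"
    using \<open>0 \<le> hold y\<close> move_nonneg unfolding eq h by (subst ennreal_plus[symmetric]) auto
qed

lemma hold_measurable[measurable]: "hold \<in> borel_measurable borel"
proof -
  have "(\<lambda>y. \<integral>y'. move y y' \<partial>lborel) \<in> borel_measurable borel"
    by (rule lborel.borel_measurable_lebesgue_integral) measurable
  then show ?thesis by (simp add: reject_marg_def[abs_def] move_def)
qed

text \<open>
  The common form of the two kernels: MarCo and OneBlockMH differ only in the distribution \<open>N\<close> of the new state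
  when the marginal move is rejected.
\<close>

definition move_or_stay :: "'b \<Rightarrow> ('a \<times> 'b) measure \<Rightarrow> ('a \<times> 'b) measure" where
  "move_or_stay y N = measure_of UNIV (sets borel) (\<lambda>A.
     (\<integral>\<^sup>+y'. emeasure (fibre y') A * ennreal (move y y') \<partial>lborel) + ennreal (hold y) * emeasure N A)"

lemma sets_move_or_stay: "sets (move_or_stay y N) = sets borel"
  unfolding move_or_stay_def using sets.sigma_sets_eq[of "borel :: ('a \<times> 'b) measure"] by simp

lemma emeasure_move_or_stay:
  assumes N: "sets N = sets borel" and A: "A \<in> sets borel"
  shows "emeasure (move_or_stay y N) A =
    (\<integral>\<^sup>+y'. emeasure (fibre y') A * ennreal (move y y') \<partial>lborel) + ennreal (hold y) * emeasure N A"
    (is "_ = ?\<mu> A")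
  unfolding move_or_stay_def
proof (rule emeasure_measure_of_sigma)
  show "sigma_algebra UNIV (sets (borel :: ('a \<times> 'b) measure))"
    using sets.sigma_algebra_axioms[of "borel :: ('a \<times> 'b) measure"] by simp
  show "positive (sets borel) ?\<mu>" by (simp add: positive_def)
  show "countably_additive (sets borel) ?\<mu>"
    unfolding countably_additive_def
  proof (intro allI impI)
    fix F :: "nat \<Rightarrow> ('a \<times> 'b) set"
    assume F: "range F \<subseteq> sets borel" and dis: "disjoint_family F"
    then have Fi[measurable]: "F i \<in> sets borel" for i by auto
    have f: "(\<Sum>i. emeasure (fibre y') (F i)) = emeasure (fibre y') (\<Union>i. F i)" for y'
      by (rule suminf_emeasure) (use F dis in \<open>auto simp: sets_fibre\<close>)
    have n: "(\<Sum>i. emeasure N (F i)) = emeasure N (\<Union>i. F i)"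
      by (rule suminf_emeasure) (use F dis in \<open>auto simp: N\<close>)
    have "(\<Sum>i. ?\<mu> (F i)) = (\<Sum>i. \<integral>\<^sup>+y'. emeasure (fibre y') (F i) * ennreal (move y y') \<partial>lborel) +
        (\<Sum>i. ennreal (hold y) * emeasure N (F i))"
      by (rule suminf_add[symmetric]) auto
    also have "(\<Sum>i. \<integral>\<^sup>+y'. emeasure (fibre y') (F i) * ennreal (move y y') \<partial>lborel) =
        (\<integral>\<^sup>+y'. (\<Sum>i. emeasure (fibre y') (F i) * ennreal (move y y')) \<partial>lborel)"
      by (rule nn_integral_suminf[symmetric]) measurable
    finally show "(\<Sum>i. ?\<mu> (F i)) = ?\<mu> (\<Union>i. F i)"
      by (simp add: f n)
  qed
qed (rule A)

lemma nn_integral_move_or_stay: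
  assumes N: "sets N = sets borel" and F: "F \<in> borel_measurable borel"
  shows "(\<integral>\<^sup>+w. F w \<partial>move_or_stay y N) =
    (\<integral>\<^sup>+y'. (\<integral>\<^sup>+w. F w \<partial>fibre y') * ennreal (move y y') \<partial>lborel) + ennreal (hold y) * (\<integral>\<^sup>+w. F w \<partial>N)"
  using F
proof (induction rule: borel_measurable_induct)
  case (cong f g)
  then have "f = g" by auto
  with cong show ?case by simp
next
  case (set A)
  then show ?case
    by (simp add: sets_move_or_stay sets_fibre N emeasure_move_or_stay[OF N])
next
  case (mult u k)
  note [measurable] = mult(2)
  note meas = measurable_cong_sets[OF sets_move_or_stay refl] measurable_cong_sets[OF sets_fibre refl]
    measurable_cong_sets[OF N refl]
  show ?case
    using mult by (simp add: nn_integral_cmult meas mult.assoc distrib_left mult.left_commute)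
next
  case (add u v)
  note [measurable] = add(1,4)
  note meas = measurable_cong_sets[OF sets_move_or_stay refl] measurable_cong_sets[OF sets_fibre refl]
    measurable_cong_sets[OF N refl]
  show ?case
    using add by (simp add: nn_integral_add meas distrib_left distrib_right ac_simps)
next
  case (seq U)
  note [measurable] = seq(1)
  note meas = measurable_cong_sets[OF sets_move_or_stay refl] measurable_cong_sets[OF sets_fibre refl]
    measurable_cong_sets[OF N refl]
  have SUP: "(\<integral>\<^sup>+w. (SUP i. U i) w \<partial>L) = (SUP i. \<integral>\<^sup>+w. U i w \<partial>L)" if "sets L = sets borel" for L
    using seq(3) unfolding SUP_apply
    by (intro nn_integral_monotone_convergence_SUP) (auto simp: measurable_cong_sets[OF that refl] seq(1))
  have mono: "incseq (\<lambda>i. \<integral>\<^sup>+w. U i w \<partial>L)" for L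
    using seq(3) by (auto simp: incseq_def le_fun_def intro!: nn_integral_mono)
  have inc1: "incseq (\<lambda>i y'. (\<integral>\<^sup>+w. U i w \<partial>fibre y') * ennreal (move y y'))"
    using mono by (auto simp: incseq_def le_fun_def intro!: mult_right_mono)
  have "(\<integral>\<^sup>+y'. (\<integral>\<^sup>+w. (SUP i. U i) w \<partial>fibre y') * ennreal (move y y') \<partial>lborel) =
      (SUP i. \<integral>\<^sup>+y'. (\<integral>\<^sup>+w. U i w \<partial>fibre y') * ennreal (move y y') \<partial>lborel)"
    unfolding SUP[OF sets_fibre] SUP_mult_right_ennreal
    by (intro nn_integral_monotone_convergence_SUP inc1) measurable
  moreover have "ennreal (hold y) * (\<integral>\<^sup>+w. (SUP i. U i) w \<partial>N) = (SUP i. ennreal (hold y) * (\<integral>\<^sup>+w. U i w \<partial>N))"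
    unfolding SUP[OF N] by (rule SUP_mult_left_ennreal)
  moreover have "incseq (\<lambda>i. \<integral>\<^sup>+y'. (\<integral>\<^sup>+w. U i w \<partial>fibre y') * ennreal (move y y') \<partial>lborel)"
    using inc1 by (auto simp: incseq_def le_fun_def intro!: nn_integral_mono)
  moreover have "incseq (\<lambda>i. ennreal (hold y) * (\<integral>\<^sup>+w. U i w \<partial>N))"
    using mono[of N] by (auto simp: incseq_def intro!: mult_left_mono)
  ultimately show ?case
    unfolding SUP[OF sets_move_or_stay] by (simp add: ennreal_SUP_add[symmetric] seq.IH)
qed

lemma prob_space_move_or_stay:
  assumes "prob_space N" and N: "sets N = sets borel"
  shows "prob_space (move_or_stay y N)"
proof (rule prob_spaceI)
  have [simp]: "space (move_or_stay y N) = UNIV" "space N = UNIV" "space (fibre y') = UNIV" for y'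
    using sets_eq_imp_space_eq[OF sets_move_or_stay] sets_eq_imp_space_eq[OF N]
      sets_eq_imp_space_eq[OF sets_fibre] by simp_all
  have "emeasure N UNIV = 1" using prob_space.emeasure_space_1[OF assms(1)] by simp
  moreover have "emeasure (fibre y') UNIV = 1" for y'
    using prob_space.emeasure_space_1[OF prob_space_fibre, of y'] by simp
  ultimately show "emeasure (move_or_stay y N) (space (move_or_stay y N)) = 1"
    by (simp add: emeasure_move_or_stay[OF N] move_hold_total)
qed

lemma measurable_move_or_stay:
  fixes N :: "'a \<times> 'b \<Rightarrow> ('a \<times> 'b) measure"
  assumes N: "N \<in> borel \<rightarrow>\<^sub>M prob_algebra borel"
  shows "(\<lambda>z. move_or_stay (snd z) (N z)) \<in> borel \<rightarrow>\<^sub>M prob_algebra (borel :: ('a \<times> 'b) measure)"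
proof (rule measurable_prob_algebraI)
  have Nz: "sets (N z) = sets borel" "prob_space (N z)" for z
    using measurable_space[OF N, of z] by (auto simp: space_prob_algebra)
  show "prob_space (move_or_stay (snd z) (N z))" for z
    by (rule prob_space_move_or_stay[OF Nz(2,1)])
  fix A :: "('a \<times> 'b) set" assume A[measurable]: "A \<in> sets borel"
  note [measurable] = measurable_prob_algebraD[OF N]
  have "(\<lambda>z :: 'a \<times> 'b. (\<integral>\<^sup>+y'. emeasure (fibre y') A * ennreal (move (snd z) y') \<partial>lborel) +
      ennreal (hold (snd z)) * emeasure (N z) A) \<in> borel_measurable borel"
  proof -
    have 1: "(\<lambda>y. \<integral>\<^sup>+y'. emeasure (fibre y') A * ennreal (move y y') \<partial>lborel) \<in> borel_measurable borel"
      by measurable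
    have 2: "(snd :: 'a \<times> 'b \<Rightarrow> 'b) \<in> borel_measurable borel"
      unfolding borel_prod[symmetric] by measurable
    note [measurable] = measurable_compose[OF 2 1] measurable_compose[OF 2 hold_measurable]
    show ?thesis by measurable
  qed
  then show "(\<lambda>z. emeasure (move_or_stay (snd z) (N z)) A) \<in> borel_measurable borel"
    by (simp add: emeasure_move_or_stay[OF Nz(1) A])
qed (rule sets_move_or_stay)

lemma sigma_sets_borel: "sigma_sets UNIV (sets borel) = sets (borel :: ('a \<times> 'b) measure)"
  using sets.sigma_sets_eq[of "borel :: ('a \<times> 'b) measure"] by simp

lemma marco_kernel_eq: "marco_kernel c p q z = move_or_stay (snd z) (fibre (snd z))"
  unfolding marco_kernel_def move_or_stay_def move_def case_prod_beta
  by (rule measure_of_eq) (auto simp: emeasure_fibre sigma_sets_borel)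

lemma oneblock_kernel_eq: "oneblock_kernel c p q z = move_or_stay (snd z) (return borel z)"
  unfolding oneblock_kernel_def move_or_stay_def move_def case_prod_beta
  by (rule measure_of_eq) (auto simp: emeasure_fibre sigma_sets_borel)

lemma snd_measurable: "(snd :: 'a \<times> 'b \<Rightarrow> 'b) \<in> borel_measurable borel"
  unfolding borel_prod[symmetric] by measurable

lemma measurable_kernel_joint:
  "K \<in> borel \<rightarrow>\<^sub>M prob_algebra borel \<Longrightarrow> K \<in> \<pi> \<rightarrow>\<^sub>M prob_algebra \<pi>"
  by (simp add: prob_algebra_def subprob_algebra_cong[OF sets_joint] measurable_cong_sets[OF sets_joint refl])

lemma nn_integral_oneblock:
  assumes "F \<in> borel_measurable borel"
  shows "(\<integral>\<^sup>+w. F w \<partial>oneblock_kernel c p q z) =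
    (\<integral>\<^sup>+y'. (\<integral>\<^sup>+w. F w \<partial>fibre y') * ennreal (move (snd z) y') \<partial>lborel) + F z * ennreal (hold (snd z))"
  unfolding oneblock_kernel_eq by (subst nn_integral_move_or_stay) (use assms in \<open>auto simp: nn_integral_return mult.commute\<close>)

lemma nn_integral_marco:
  assumes "F \<in> borel_measurable borel"
  shows "(\<integral>\<^sup>+w. F w \<partial>marco_kernel c p q z) =
    (\<integral>\<^sup>+y'. (\<integral>\<^sup>+w. F w \<partial>fibre y') * ennreal (move (snd z) y') \<partial>lborel) +
      (\<integral>\<^sup>+w. F w \<partial>fibre (snd z)) * ennreal (hold (snd z))"
  unfolding marco_kernel_eq by (subst nn_integral_move_or_stay) (use assms in \<open>auto simp: sets_fibre mult.commute\<close>)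

abbreviation "refresh \<equiv> \<lambda>z :: 'a \<times> 'b. fibre (snd z)"

lemma measurable_refresh: "refresh \<in> borel \<rightarrow>\<^sub>M prob_algebra borel"
  by (rule measurable_compose[OF snd_measurable measurable_fibre])

lemma measurable_oneblock: "oneblock_kernel c p q \<in> borel \<rightarrow>\<^sub>M prob_algebra borel"
  using measurable_move_or_stay[of "return borel"] by (simp add: oneblock_kernel_eq[abs_def, symmetric])

lemma reversible_refresh: "reversible_kernel \<pi> refresh"
proof (intro reversible_kernel.intro reversible_kernel_axioms.intro prob_joint
    measurable_kernel_joint[OF measurable_refresh])
  fix u v :: "'a \<times> 'b \<Rightarrow> ennreal"
  assume "u \<in> borel_measurable \<pi>" "v \<in> borel_measurable \<pi>"
  then have [measurable]: "u \<in> borel_measurable borel" "v \<in> borel_measurable borel"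
    by (simp_all add: measurable_cong_sets[OF sets_joint refl])
  have *: "(\<integral>\<^sup>+z. u z * (\<integral>\<^sup>+w. v w \<partial>fibre (snd z)) \<partial>\<pi>) =
      (\<integral>\<^sup>+y. ennreal (p y) * ((\<integral>\<^sup>+w. u w \<partial>fibre y) * (\<integral>\<^sup>+w. v w \<partial>fibre y)) \<partial>lborel)"
    if [measurable]: "u \<in> borel_measurable borel" "v \<in> borel_measurable borel"
    for u v :: "'a \<times> 'b \<Rightarrow> ennreal"
  proof -
    have "(\<lambda>y. \<integral>\<^sup>+w. v w \<partial>fibre y) \<in> borel_measurable borel" by measurable
    note [measurable] = measurable_compose[OF snd_measurable this]
    have "(\<lambda>z. u z * (\<integral>\<^sup>+w. v w \<partial>fibre (snd z))) \<in> borel_measurable borel" by measurable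
    from nn_integral_joint[OF this] show ?thesis
      by (simp only: nn_integral_fibre_snd[OF that(1), of _ "\<lambda>y. \<integral>\<^sup>+w. v w \<partial>fibre y"])
  qed
  show "(\<integral>\<^sup>+z. u z * (\<integral>\<^sup>+w. v w \<partial>fibre (snd z)) \<partial>\<pi>) = (\<integral>\<^sup>+z. v z * (\<integral>\<^sup>+w. u w \<partial>fibre (snd z)) \<partial>\<pi>)"
    by (simp add: * mult.commute)
qed

text \<open>
  The accepted moves contribute the double integral of \<open>p y * move y y'\<close> against the conditional means of \<open>u\<close> at \<open>y\<close> and
  of \<open>v\<close> at \<open>y'\<close>, symmetric by detailed balance after exchanging the order of integration.  The rejected moves
  contribute the integral of \<open>u * v\<close> weighted by the rejection probability.
\<close>

lemma reversible_oneblock: "reversible_kernel \<pi> (oneblock_kernel c p q)"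
proof (intro reversible_kernel.intro reversible_kernel_axioms.intro prob_joint
    measurable_kernel_joint[OF measurable_oneblock])
  fix u v :: "'a \<times> 'b \<Rightarrow> ennreal"
  assume "u \<in> borel_measurable \<pi>" "v \<in> borel_measurable \<pi>"
  then have um: "u \<in> borel_measurable borel" and vm: "v \<in> borel_measurable borel"
    by (simp_all add: measurable_cong_sets[OF sets_joint refl])
  note [measurable] = measurable_compose[OF snd_measurable hold_measurable]
  let ?f = "\<lambda>u y. \<integral>\<^sup>+w. u w \<partial>fibre y"
  have expand: "(\<integral>\<^sup>+z. u z * (\<integral>\<^sup>+w. v w \<partial>oneblock_kernel c p q z) \<partial>\<pi>) =
      (\<integral>\<^sup>+y. (\<integral>\<^sup>+y'. ennreal (p y * move y y') * (?f u y * ?f v y') \<partial>lborel) \<partial>lborel) +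
      (\<integral>\<^sup>+y. ennreal (p y) * (?f (\<lambda>w. u w * v w) y * ennreal (hold y)) \<partial>lborel)"
    if um[measurable]: "u \<in> borel_measurable borel" and vm[measurable]: "v \<in> borel_measurable borel" for u v
  proof -
    define I where "I y = (\<integral>\<^sup>+y'. ?f v y' * ennreal (move y y') \<partial>lborel)" for y
    have Im[measurable]: "I \<in> borel_measurable borel" unfolding I_def[abs_def] by measurable
    note [measurable] = measurable_compose[OF snd_measurable Im]
    have "(\<integral>\<^sup>+z. u z * (\<integral>\<^sup>+w. v w \<partial>oneblock_kernel c p q z) \<partial>\<pi>) =
        (\<integral>\<^sup>+z. u z * I (snd z) + (u z * v z) * ennreal (hold (snd z)) \<partial>\<pi>)"
      by (simp add: nn_integral_oneblock vm I_def distrib_left mult.assoc)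
    also have "\<dots> = (\<integral>\<^sup>+y. ennreal (p y) * (\<integral>\<^sup>+w. u w * I (snd w) + (u w * v w) * ennreal (hold (snd w)) \<partial>fibre y) \<partial>lborel)"
      by (rule nn_integral_joint) measurable
    also have "\<dots> = (\<integral>\<^sup>+y. ennreal (p y) * (?f u y * I y) + ennreal (p y) * (?f (\<lambda>w. u w * v w) y * ennreal (hold y)) \<partial>lborel)"
    proof (rule nn_integral_cong)
      fix y
      have "(\<integral>\<^sup>+w. u w * I (snd w) + (u w * v w) * ennreal (hold (snd w)) \<partial>fibre y) =
          (\<integral>\<^sup>+w. u w * I (snd w) \<partial>fibre y) + (\<integral>\<^sup>+w. (u w * v w) * ennreal (hold (snd w)) \<partial>fibre y)"
        by (rule nn_integral_add) (unfold measurable_cong_sets[OF sets_fibre refl], measurable)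
      also have "\<dots> = ?f u y * I y + ?f (\<lambda>w. u w * v w) y * ennreal (hold y)"
        using nn_integral_fibre_snd[of u y I] nn_integral_fibre_snd[of "\<lambda>w. u w * v w" y "\<lambda>y. ennreal (hold y)"]
        by simp
      finally show "ennreal (p y) * (\<integral>\<^sup>+w. u w * I (snd w) + (u w * v w) * ennreal (hold (snd w)) \<partial>fibre y) =
          ennreal (p y) * (?f u y * I y) + ennreal (p y) * (?f (\<lambda>w. u w * v w) y * ennreal (hold y))"
        by (simp add: distrib_left)
    qed
    also have "\<dots> = (\<integral>\<^sup>+y. ennreal (p y) * (?f u y * I y) \<partial>lborel) +
        (\<integral>\<^sup>+y. ennreal (p y) * (?f (\<lambda>w. u w * v w) y * ennreal (hold y)) \<partial>lborel)"
      by (rule nn_integral_add) measurable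
    also have "(\<integral>\<^sup>+y. ennreal (p y) * (?f u y * I y) \<partial>lborel) =
        (\<integral>\<^sup>+y. (\<integral>\<^sup>+y'. ennreal (p y * move y y') * (?f u y * ?f v y') \<partial>lborel) \<partial>lborel)"
    proof (rule nn_integral_cong)
      fix y
      have "ennreal (p y) * (?f u y * I y) =
          (\<integral>\<^sup>+y'. (ennreal (p y) * ?f u y) * (?f v y' * ennreal (move y y')) \<partial>lborel)"
        unfolding I_def by (subst nn_integral_cmult) (auto simp: mult.assoc)
      then show "ennreal (p y) * (?f u y * I y) = (\<integral>\<^sup>+y'. ennreal (p y * move y y') * (?f u y * ?f v y') \<partial>lborel)"
        by (simp add: ennreal_mult p_nonneg move_nonneg ac_simps)
    qed
    finally show ?thesis .
  qed
  have "(\<integral>\<^sup>+y. (\<integral>\<^sup>+y'. ennreal (p y * move y y') * (?f u y * ?f v y') \<partial>lborel) \<partial>lborel) =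
      (\<integral>\<^sup>+y'. (\<integral>\<^sup>+y. ennreal (p y * move y y') * (?f u y * ?f v y') \<partial>lborel) \<partial>lborel)"
    by (rule lborel_pair.Fubini'[symmetric]) (use um vm in measurable)
  also have "\<dots> = (\<integral>\<^sup>+y. (\<integral>\<^sup>+y'. ennreal (p y * move y y') * (?f v y * ?f u y') \<partial>lborel) \<partial>lborel)"
    using detailed_balance by (intro nn_integral_cong) (metis mult.commute)
  finally show "(\<integral>\<^sup>+z. u z * (\<integral>\<^sup>+w. v w \<partial>oneblock_kernel c p q z) \<partial>\<pi>) =
      (\<integral>\<^sup>+z. v z * (\<integral>\<^sup>+w. u w \<partial>oneblock_kernel c p q z) \<partial>\<pi>)"
    unfolding expand[OF um vm] expand[OF vm um] by (simp add: mult.commute)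
qed

lemma sets_oneblock: "sets (oneblock_kernel c p q z) = sets borel"
  and sets_marco: "sets (marco_kernel c p q z) = sets borel"
  by (simp_all add: oneblock_kernel_eq marco_kernel_eq sets_move_or_stay)

lemma measure_eqI_nn_integral_borel:
  assumes "sets N = sets borel" "sets L = sets borel"
    and "\<And>F :: 'a \<times> 'b \<Rightarrow> ennreal. F \<in> borel_measurable borel \<Longrightarrow> (\<integral>\<^sup>+w. F w \<partial>N) = (\<integral>\<^sup>+w. F w \<partial>L)"
  shows "N = L"
proof (rule measure_eqI)
  fix A assume "A \<in> sets N"
  then show "emeasure N A = emeasure L A"
    using assms(3)[of "indicator A"] assms(1,2) by simp
qed (simp add: assms)

lemma nn_integral_bind_borel:
  assumes L: "sets L = sets borel" and K: "K \<in> borel \<rightarrow>\<^sub>M prob_algebra borel" and F: "F \<in> borel_measurable borel"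
  shows "(\<integral>\<^sup>+w. F w \<partial>(L \<bind> K)) = (\<integral>\<^sup>+w. (\<integral>\<^sup>+x. F x \<partial>K w) \<partial>L)"
  by (rule nn_integral_bind[OF F])
     (simp add: measurable_cong_sets[OF L refl] measurable_prob_algebraD[OF K])

lemma sets_bind_borel:
  assumes L: "sets L = sets (borel :: ('a \<times> 'b) measure)" and K: "K \<in> borel \<rightarrow>\<^sub>M prob_algebra borel"
  shows "sets (L \<bind> K) = sets borel"
proof (rule sets_bind)
  show "space L \<noteq> {}" using sets_eq_imp_space_eq[OF L] by simp
  show "sets (K x) = sets borel" for x
    using measurable_space[OF K, of x] by (simp add: space_prob_algebra)
qed

lemma refresh_then_refresh: "refresh z \<bind> refresh = refresh z"
proof (rule measure_eqI_nn_integral_borel)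
  show "sets (refresh z \<bind> refresh) = sets borel"
    by (rule sets_bind_borel[OF sets_fibre measurable_refresh])
  fix F :: "'a \<times> 'b \<Rightarrow> ennreal" assume F: "F \<in> borel_measurable borel"
  have "(\<integral>\<^sup>+w. 1 * (\<integral>\<^sup>+x. F x \<partial>fibre (snd w)) \<partial>fibre y) = (\<integral>\<^sup>+w. 1 \<partial>fibre y) * (\<integral>\<^sup>+x. F x \<partial>fibre y)" for y
    by (rule nn_integral_fibre_snd) simp
  then show "(\<integral>\<^sup>+w. F w \<partial>(refresh z \<bind> refresh)) = (\<integral>\<^sup>+w. F w \<partial>refresh z)"
    by (simp add: nn_integral_bind_borel[OF sets_fibre measurable_refresh F]
      prob_space.emeasure_space_1[OF prob_space_fibre])
qed (rule sets_fibre)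

lemma nn_integral_refresh_const_on_fibres:
  "(\<integral>\<^sup>+w. G (snd w) \<partial>fibre y) = (G y :: ennreal)"
  using nn_integral_fibre_snd[of "\<lambda>_. 1" y G] by (simp add: prob_space.emeasure_space_1[OF prob_space_fibre])

text \<open>
  Refreshing first does not influence the marginal move, and after a rejection the held state is the refreshed one.
\<close>

lemma refresh_then_oneblock: "refresh z \<bind> oneblock_kernel c p q = marco_kernel c p q z"
proof (rule measure_eqI_nn_integral_borel)
  show "sets (refresh z \<bind> oneblock_kernel c p q) = sets borel"
    by (rule sets_bind_borel[OF sets_fibre measurable_oneblock])
  fix F :: "'a \<times> 'b \<Rightarrow> ennreal" assume F[measurable]: "F \<in> borel_measurable borel"
  define I where "I y = (\<integral>\<^sup>+y'. (\<integral>\<^sup>+w. F w \<partial>fibre y') * ennreal (move y y') \<partial>lborel)" for y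
  have Im[measurable]: "I \<in> borel_measurable borel" unfolding I_def[abs_def] by measurable
  note [measurable] = measurable_compose[OF snd_measurable Im] measurable_compose[OF snd_measurable hold_measurable]
  have "(\<integral>\<^sup>+w. F w \<partial>(refresh z \<bind> oneblock_kernel c p q)) =
      (\<integral>\<^sup>+w. I (snd w) + F w * ennreal (hold (snd w)) \<partial>fibre (snd z))"
    by (simp add: nn_integral_bind_borel[OF sets_fibre measurable_oneblock F] nn_integral_oneblock[OF F] I_def)
  also have "\<dots> = (\<integral>\<^sup>+w. I (snd w) \<partial>fibre (snd z)) + (\<integral>\<^sup>+w. F w * ennreal (hold (snd w)) \<partial>fibre (snd z))"
    by (rule nn_integral_add) (unfold measurable_cong_sets[OF sets_fibre refl], measurable)
  also have "\<dots> = I (snd z) + (\<integral>\<^sup>+w. F w \<partial>fibre (snd z)) * ennreal (hold (snd z))"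
    using nn_integral_fibre_snd[of F "snd z" "\<lambda>y. ennreal (hold y)"] nn_integral_refresh_const_on_fibres[of "snd z" I]
    by simp
  finally show "(\<integral>\<^sup>+w. F w \<partial>(refresh z \<bind> oneblock_kernel c p q)) = (\<integral>\<^sup>+w. F w \<partial>marco_kernel c p q z)"
    by (simp add: nn_integral_marco[OF F] I_def)
qed (rule sets_marco)

text \<open>
  An accepted move already draws \<open>x\<close> from the conditional distribution, so refreshing changes nothing; after a
  rejection it replaces the held \<open>x\<close>.
\<close>

lemma oneblock_then_refresh: "oneblock_kernel c p q z \<bind> refresh = marco_kernel c p q z"
proof (rule measure_eqI_nn_integral_borel)
  show "sets (oneblock_kernel c p q z \<bind> refresh) = sets borel"
    by (rule sets_bind_borel[OF sets_oneblock measurable_refresh])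
  fix F :: "'a \<times> 'b \<Rightarrow> ennreal" assume F[measurable]: "F \<in> borel_measurable borel"
  have "(\<lambda>y. \<integral>\<^sup>+x. F x \<partial>fibre y) \<in> borel_measurable borel" by measurable
  from nn_integral_oneblock[OF measurable_compose[OF snd_measurable this], of z]
  show "(\<integral>\<^sup>+w. F w \<partial>(oneblock_kernel c p q z \<bind> refresh)) = (\<integral>\<^sup>+w. F w \<partial>marco_kernel c p q z)"
    unfolding nn_integral_bind_borel[OF sets_oneblock measurable_refresh F] nn_integral_marco[OF F]
    by (simp add: nn_integral_refresh_const_on_fibres[of _ "\<lambda>y. \<integral>\<^sup>+x. F x \<partial>fibre y"])
qed (rule sets_marco)

lemma refreshment_oneblock:
  "refreshment \<pi> refresh (oneblock_kernel c p q) (marco_kernel c p q) (\<lambda>z. hold (snd z))"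
proof (intro refreshment.intro refreshment_axioms.intro reversible_refresh reversible_oneblock
    refresh_then_oneblock oneblock_then_refresh refresh_then_refresh hold_nonneg hold_le_1)
  show "(\<lambda>z. hold (snd z)) \<in> borel_measurable \<pi>"
    unfolding measurable_cong_sets[OF sets_joint refl]
    by (rule measurable_compose[OF snd_measurable hold_measurable])
  show "AE w in fibre (snd z). hold (snd w) = hold (snd z)" for z :: "'a \<times> 'b"
    using AE_fibre[of "snd z"] by eventually_elim simp
  show "(\<integral>\<^sup>+w. f w \<partial>oneblock_kernel c p q z) + ennreal (hold (snd z)) * (\<integral>\<^sup>+w. f w \<partial>fibre (snd z)) =
      (\<integral>\<^sup>+w. f w \<partial>marco_kernel c p q z) + ennreal (hold (snd z)) * f z"
    if "f \<in> borel_measurable \<pi>" for z and f :: "'a \<times> 'b \<Rightarrow> ennreal"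
    using that unfolding measurable_cong_sets[OF sets_joint refl]
    by (simp add: nn_integral_oneblock nn_integral_marco ac_simps)
qed

text \<open>
  Any bounded function that is almost nowhere equal to its conditional mean yields such a \<open>\<phi>\<close> by centring.  A
  strictly monotone function of one coordinate of \<open>x\<close> qualifies, since a conditional density charges no
  hyperplane; the arctangent makes it bounded.
\<close>

lemma exists_conditionally_centred:
  "\<exists>\<phi> \<in> square_integrable \<pi>. (AE z in \<pi>. kernel_op refresh \<phi> z = 0) \<and> (AE z in \<pi>. \<phi> z \<noteq> 0)"
proof -
  interpret R: refreshment \<pi> refresh "oneblock_kernel c p q" "marco_kernel c p q" "\<lambda>z. hold (snd z)"
    by (rule refreshment_oneblock)
  obtain b :: 'a where b: "b \<in> Basis" using nonempty_Basis by blast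
  define g where "g z = arctan (fst z \<bullet> b)" for z :: "'a \<times> 'b"
  have "continuous_on UNIV g" unfolding g_def[abs_def] by (intro continuous_intros)
  then have gm: "g \<in> borel_measurable \<pi>"
    unfolding measurable_cong_sets[OF sets_joint refl] by (rule borel_measurable_continuous_onI)
  have "\<bar>g z\<bar> \<le> pi / 2" for z
    using arctan_lbound[of "fst z \<bullet> b"] arctan_ubound[of "fst z \<bullet> b"] by (simp add: g_def)
  then have "(\<lambda>z. g z * 1) \<in> square_integrable \<pi>"
    by (intro square_integrable_bounded_mult[OF R.E.square_integrable_const gm])
  then have g2: "g \<in> square_integrable \<pi>" by simp
  define \<phi> where "\<phi> z = g z - kernel_op refresh g z" for z
  have \<phi>2: "\<phi> \<in> square_integrable \<pi>"
    unfolding \<phi>_def[abs_def] by (rule R.residual_square_integrable[OF g2])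
  have \<phi>0: "AE z in \<pi>. kernel_op refresh \<phi> z = 0"
    unfolding \<phi>_def[abs_def] by (rule R.PE_residual[OF g2])
  have \<phi>m[measurable]: "\<phi> \<in> borel_measurable borel"
    using square_integrableD(1)[OF \<phi>2] by (simp add: measurable_cong_sets[OF sets_joint refl])
  have fib: "AE w in fibre y. \<phi> w \<noteq> 0" for y
  proof -
    define m where "m = (\<integral>w. g w \<partial>fibre y)"
    have "AE x in lborel. x \<bullet> b \<noteq> tan m" by (rule AE_lborel_inner_neq[OF b])
    then have "AE x in lborel. \<phi> (x, y) \<noteq> 0"
    proof eventually_elim
      case (elim x)
      have "arctan (x \<bullet> b) \<noteq> m" using elim by (metis tan_arctan)
      then show ?case by (simp add: \<phi>_def g_def[of "(x, y)"] kernel_op_def m_def)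
    qed
    then have "AE x in cond_dist c y. \<phi> (x, y) \<noteq> 0"
      unfolding cond_dist_def by (subst AE_density) (auto elim!: eventually_mono)
    moreover have "{w \<in> space borel. \<phi> w \<noteq> 0} \<in> sets borel" by measurable
    ultimately show ?thesis
      unfolding fibre_def by (subst AE_distr_iff[OF Pair_measurable_cond_dist]) auto
  qed
  have "AE z in \<pi>. \<phi> z \<noteq> 0"
  proof -
    have "fibre \<in> density lborel (\<lambda>y. ennreal (p y)) \<rightarrow>\<^sub>M subprob_algebra borel"
      using measurable_fibre_sub by simp
    moreover have "Measurable.pred borel (\<lambda>z. \<phi> z \<noteq> 0)" by measurable
    ultimately have "(AE z in density lborel (\<lambda>y. ennreal (p y)) \<bind> fibre. \<phi> z \<noteq> 0) \<longleftrightarrow>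
        (AE y in density lborel (\<lambda>y. ennreal (p y)). AE w in fibre y. \<phi> w \<noteq> 0)"
      by (rule AE_bind)
    then show ?thesis using fib unfolding joint fibre_def[abs_def] by simp
  qed
  with \<phi>2 \<phi>0 show ?thesis by blast
qed

end

theorem theorem5p2:
  fixes \<pi>_joint :: "((real ^ 'm) \<times> (real ^ 'n)) measure"
    and \<pi>_cond :: "real ^ 'n \<Rightarrow> real ^ 'm \<Rightarrow> real"
    and \<pi>_marg :: "real ^ 'n \<Rightarrow> real"
    and q_marg :: "real ^ 'n \<Rightarrow> real ^ 'n \<Rightarrow> real"
  assumes prob: "prob_space \<pi>_joint"
    and abs_cont: "absolutely_continuous lborel \<pi>_joint"
    and marg_nonneg: "\<And>y. 0 \<le> \<pi>_marg y"
    and marg: "distributed \<pi>_joint lborel snd (\<lambda>y. ennreal (\<pi>_marg y))"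
    and cond: "conditional_density \<pi>_cond"
    and joint: "\<pi>_joint = density lborel (\<lambda>y. ennreal (\<pi>_marg y)) \<bind>
                  (\<lambda>y. distr (cond_dist \<pi>_cond y) borel (\<lambda>x. (x, y)))"
    and proposal: "conditional_density q_marg"
  shows "right_gap \<pi>_joint (marco_kernel \<pi>_cond \<pi>_marg q_marg)
           \<ge> right_gap \<pi>_joint (oneblock_kernel \<pi>_cond \<pi>_marg q_marg) \<and>
         (\<forall>f \<in> square_integrable \<pi>_joint.
            asymp_var \<pi>_joint (marco_kernel \<pi>_cond \<pi>_marg q_marg) f
              \<le> asymp_var \<pi>_joint (oneblock_kernel \<pi>_cond \<pi>_marg q_marg) f)"
proof -
  have "(\<lambda>y. ennreal (\<pi>_marg y)) \<in> borel_measurable borel"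
    using distributed_borel_measurable[OF marg] by simp
  then have "(\<lambda>y. enn2real (ennreal (\<pi>_marg y))) \<in> borel_measurable borel" by measurable
  then have meas: "\<pi>_marg \<in> borel_measurable borel" by (simp add: marg_nonneg)
  interpret marginal_metropolis \<pi>_cond \<pi>_marg q_marg \<pi>_joint
    by (rule marginal_metropolis.intro[OF cond proposal meas marg_nonneg prob joint])
  interpret R: refreshment \<pi>_joint refresh "oneblock_kernel \<pi>_cond \<pi>_marg q_marg"
      "marco_kernel \<pi>_cond \<pi>_marg q_marg" "\<lambda>z. hold (snd z)"
    by (rule refreshment_oneblock)
  obtain \<phi> where "\<phi> \<in> square_integrable \<pi>_joint" "AE z in \<pi>_joint. kernel_op refresh \<phi> z = 0"
    "AE z in \<pi>_joint. \<phi> z \<noteq> 0"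
    using exists_conditionally_centred by blast
  then show ?thesis
    using R.right_gap_refreshed_ge R.asymp_var_refreshed_le by blast
qed

end
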